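(* The equational theory of the time warp algebra $\mathbf{W}=\langle W,\wedge,\vee,\circ,\backslash,/,\mathrm{id},\bot,\top\rangle$ is decidable. That is, there is an algorithm which, given two time warp terms $s,t$, decides whether $\mathbf{W}\models s\approx t$, i.e. whether $s$ and $t$ evaluate to the same time warp under every assignment of time warps to the variables.
   Context: Let $\overline{\omega}=\omega\cup\{\omega\}$ be the natural numbers with a top element $\omega$ adjoined, with its natural total order. A time warp is a monotone map $f\colon\overline{\omega}\to\overline{\omega}$ with $f(0)=0$ and $f(\omega)=\bigvee\{f(n)\mid n\in\omega\}$ (equivalently, a sup-preserving map $\overline\omega\to\overline\omega$). Let $W$ be the set of time warps, ordered pointwise ($f\le g$ iff $f(p)\le g(p)$ for all $p$); $\wedge,\vee$ are the pointwise meet and join, $fg:=f\circ g$ is composition, $\mathrm{id}$ is the identity, $\bot$ is the constant map $0$, and $\top$ maps every $p\neq 0$ to $\omega$ (and $0$ to $0$). The residuals $\backslash,/$ are the binary operations on $W$ satisfying, for all $f,g,h\in W$: $f\le h/g \iff fg\le h \iff g\le f\backslash h$. The time warp algebra is $\mathbf{W}=\langle W,\wedge,\vee,\circ,\backslash,/,\mathrm{id},\bot,\top\rangle$. A time warp term is a term built from a countably infinite set of variables using the binary symbols $\wedge,\vee,\circ,\backslash,/$ and constants $\mathrm{id},\bot,\top$; an equation $s\approx t$ holds in $\mathbf{W}$ if both sides are equal under every valuation of variables in $W$. *)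

theory Defs
  imports Main "HOL-Library.Extended_Nat" "HOL-Library.Nat_Bijection"
begin

text \<open>The chain omega-bar is modelled by enat (infinity plays the role of omega).\<close>

definition time_warps :: "(enat \<Rightarrow> enat) set" where
  "time_warps = {f. mono f \<and> f 0 = 0 \<and> f \<infinity> = (SUP n::nat. f (enat n))}"

definition tw_bot :: "enat \<Rightarrow> enat" where
  "tw_bot = (\<lambda>_. 0)"

definition tw_top :: "enat \<Rightarrow> enat" where
  "tw_top = (\<lambda>p. if p = 0 then 0 else \<infinity>)"

definition tw_ldiv :: "(enat \<Rightarrow> enat) \<Rightarrow> (enat \<Rightarrow> enat) \<Rightarrow> (enat \<Rightarrow> enat)" where
  "tw_ldiv f h = (THE r. r \<in> time_warps \<and> (\<forall>g\<in>time_warps. g \<le> r \<longleftrightarrow> f \<circ> g \<le> h))"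

definition tw_rdiv :: "(enat \<Rightarrow> enat) \<Rightarrow> (enat \<Rightarrow> enat) \<Rightarrow> (enat \<Rightarrow> enat)" where
  "tw_rdiv h g = (THE r. r \<in> time_warps \<and> (\<forall>f\<in>time_warps. f \<le> r \<longleftrightarrow> f \<circ> g \<le> h))"

datatype tw_term =
    TVar nat
  | TMeet tw_term tw_term
  | TJoin tw_term tw_term
  | TComp tw_term tw_term
  | TLdiv tw_term tw_term
  | TRdiv tw_term tw_term
  | TId
  | TBot
  | TTop

primrec tw_eval :: "(nat \<Rightarrow> (enat \<Rightarrow> enat)) \<Rightarrow> tw_term \<Rightarrow> (enat \<Rightarrow> enat)" where
  "tw_eval v (TVar i) = v i"
| "tw_eval v (TMeet s t) = inf (tw_eval v s) (tw_eval v t)"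
| "tw_eval v (TJoin s t) = sup (tw_eval v s) (tw_eval v t)"
| "tw_eval v (TComp s t) = tw_eval v s \<circ> tw_eval v t"
| "tw_eval v (TLdiv s t) = tw_ldiv (tw_eval v s) (tw_eval v t)"
| "tw_eval v (TRdiv s t) = tw_rdiv (tw_eval v s) (tw_eval v t)"
| "tw_eval v TId = id"
| "tw_eval v TBot = tw_bot"
| "tw_eval v TTop = tw_top"

definition W_models :: "tw_term \<Rightarrow> tw_term \<Rightarrow> bool" where
  "W_models s t \<longleftrightarrow> (\<forall>v. (\<forall>i. v i \<in> time_warps) \<longrightarrow> tw_eval v s = tw_eval v t)"

primrec encode_term :: "tw_term \<Rightarrow> nat" where
  "encode_term (TVar i) = prod_encode (0, i)"
| "encode_term (TMeet s t) = prod_encode (1, prod_encode (encode_term s, encode_term t))"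
| "encode_term (TJoin s t) = prod_encode (2, prod_encode (encode_term s, encode_term t))"
| "encode_term (TComp s t) = prod_encode (3, prod_encode (encode_term s, encode_term t))"
| "encode_term (TLdiv s t) = prod_encode (4, prod_encode (encode_term s, encode_term t))"
| "encode_term (TRdiv s t) = prod_encode (5, prod_encode (encode_term s, encode_term t))"
| "encode_term TId = prod_encode (6, 0)"
| "encode_term TBot = prod_encode (7, 0)"
| "encode_term TTop = prod_encode (8, 0)"

datatype recf =
    RZero
  | RSucc
  | RProj nat
  | RComp recf "recf list"
  | RPrim recf recf
  | RMini recf

inductive rec_eval :: "recf \<Rightarrow> nat list \<Rightarrow> nat \<Rightarrow> bool" where
  zero: "rec_eval RZero xs 0"
| succ: "rec_eval RSucc (x # xs) (Suc x)"
| proj: "i < length xs \<Longrightarrow> rec_eval (RProj i) xs (xs ! i)"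
| comp: "length ys = length gs \<Longrightarrow> (\<forall>i < length gs. rec_eval (gs ! i) xs (ys ! i))
          \<Longrightarrow> rec_eval f ys z \<Longrightarrow> rec_eval (RComp f gs) xs z"
| prim0: "rec_eval f xs y \<Longrightarrow> rec_eval (RPrim f g) (0 # xs) y"
| primS: "rec_eval (RPrim f g) (n # xs) y \<Longrightarrow> rec_eval g (n # y # xs) z
          \<Longrightarrow> rec_eval (RPrim f g) (Suc n # xs) z"
| mini: "rec_eval f (n # xs) 0 \<Longrightarrow> (\<forall>m < n. \<exists>y. 0 < y \<and> rec_eval f (m # xs) y)
          \<Longrightarrow> rec_eval (RMini f) xs n"

end

theory Submission
  imports Defs
begin

text \<open>
  If an equation fails under some valuation v at some point p, then only boundedly many values of
  the warps involved matter for this. Starting from the two samples (s, p) and (t, p), one closes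
  under the arguments that justify the value of a term at a point from values of its immediate
  subterms; for instance a value q of the left residual f\h at p requires f at q and at q + 1 and h
  at p. The behaviour at infinity is controlled by remembering, for every subterm, where its
  supremum is attained, if at all: every other warp with value infinity at infinity is finite at all
  finite points, and this property propagates through all operations. The resulting finite set of
  values has size bounded by an exponential in the codes of s and t; replacing each value by its
  rank keeps order, zero, infinity and all sampled successor pairs, and so yields a finite table
  with entries below a computable bound. Conversely, any table satisfying the local consistency
  conditions extends to an honest valuation by time warps. Hence an equation is valid iff
  no table below the bound refutes it, which is a bounded search.
\<close>

section \<open>Computable functions and decidable predicates\<close>

text \<open>The obstacle is the value of a residual at infinity. Meet, join and composition are
  computed pointwise there, but the pointwise residual need not preserve the supremum and has to be
  cut down to it. Its value at infinity is therefore a statement about all finite points at once.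
  Every such statement reduces to two properties of a warp: being finite at finite points, and being
  in addition infinite at infinity. Each operation has an exact criterion for the first in terms of
  its arguments and of values at infinity; this is why the table conditions speak about
  \<open>avoids_top\<close> and \<open>reaches_top_late\<close>. The delicate point of the
  compression is the successor: the rank of x + 1 exceeds that of x by one only if x itself is among
  the retained numbers. No sharp bounds are sought: any computable bound makes the search bounded
  and hence primitive recursive.\<close>

definition computable :: "nat \<Rightarrow> (nat list \<Rightarrow> nat) \<Rightarrow> bool" where
  "computable n f \<longleftrightarrow> (\<exists>p. \<forall>xs. length xs = n \<longrightarrow> rec_eval p xs (f xs))"

definition decidable :: "nat \<Rightarrow> (nat list \<Rightarrow> bool) \<Rightarrow> bool" where
  "decidable n P \<longleftrightarrow> computable n (\<lambda>xs. if P xs then 1 else 0)"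

lemma computable_cong:
  assumes "computable n f" and "\<And>xs. length xs = n \<Longrightarrow> f xs = g xs"
  shows "computable n g"
  using assms unfolding computable_def by metis

lemma computable_nth: "i < n \<Longrightarrow> computable n (\<lambda>xs. xs ! i)"
  unfolding computable_def by (metis rec_eval.proj)

lemma computable_comp:
  assumes F: "computable m F" and len: "length gs = m"
    and gs: "\<And>g. g \<in> set gs \<Longrightarrow> computable n g"
  shows "computable n (\<lambda>xs. F (map (\<lambda>g. g xs) gs))"
proof -
  obtain p where p: "\<And>xs. length xs = m \<Longrightarrow> rec_eval p xs (F xs)"
    using F unfolding computable_def by blast
  have "\<forall>g\<in>set gs. \<exists>q. \<forall>xs. length xs = n \<longrightarrow> rec_eval q xs (g xs)"
    using gs unfolding computable_def by blast
  then obtain q where q: "\<And>g xs. g \<in> set gs \<Longrightarrow> length xs = n \<Longrightarrow> rec_eval (q g) xs (g xs)"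
    by metis
  have "rec_eval (RComp p (map q gs)) xs (F (map (\<lambda>g. g xs) gs))" if "length xs = n" for xs
    by (rule rec_eval.comp[where ys = "map (\<lambda>g. g xs) gs"]) (use that q len p in auto)
  then show ?thesis unfolding computable_def by blast
qed

lemma computable_comp1:
  assumes "computable 1 (\<lambda>xs. F (hd xs))" "computable n f"
  shows "computable n (\<lambda>xs. F (f xs))"
  using computable_comp[OF assms(1), of "[f]" n] assms(2) by simp

lemma computable_comp2:
  assumes "computable 2 (\<lambda>xs. F (hd xs) (hd (tl xs)))" "computable n f" "computable n g"
  shows "computable n (\<lambda>xs. F (f xs) (g xs))"
  using computable_comp[OF assms(1), of "[f, g]" n] assms(2,3) by auto

text \<open>The argument order follows \<open>RPrim\<close>: the recursion argument is the head, and
  the step function sees the counter, the previous value and then the parameters.\<close>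

lemma computable_prim:
  assumes f: "computable n f" and g: "computable (Suc (Suc n)) g"
  shows "computable (Suc n) (\<lambda>xs. rec_nat (f (tl xs)) (\<lambda>k y. g (k # y # tl xs)) (hd xs))"
proof -
  obtain p where p: "\<And>xs. length xs = n \<Longrightarrow> rec_eval p xs (f xs)"
    using f unfolding computable_def by blast
  obtain q where q: "\<And>xs. length xs = Suc (Suc n) \<Longrightarrow> rec_eval q xs (g xs)"
    using g unfolding computable_def by blast
  have "rec_eval (RPrim p q) (k # xs) (rec_nat (f xs) (\<lambda>k y. g (k # y # xs)) k)"
    if "length xs = n" for k xs
  proof (induction k)
    case 0
    show ?case using p[OF that] by (simp add: rec_eval.prim0)
  next
    case (Suc k)
    then show ?case using q that by (auto intro: rec_eval.primS)
  qed
  then have "rec_eval (RPrim p q) xs (rec_nat (f (tl xs)) (\<lambda>k y. g (k # y # tl xs)) (hd xs))"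
    if "length xs = Suc n" for xs
    using that by (cases xs) auto
  then show ?thesis unfolding computable_def by blast
qed

lemma funpow_tl: "(tl ^^ k) xs = drop k xs"
  by (induction k) (auto simp: tl_drop drop_Suc)

lemma computable_hd_tl: "k < n \<Longrightarrow> computable n (\<lambda>xs. hd ((tl ^^ k) xs))"
  by (rule computable_cong[OF computable_nth]) (auto simp: funpow_tl hd_drop_conv_nth)

text \<open>The variables of a predicate are addressed as de Bruijn indices by iterated tails, since the
  bounded quantifiers below extend the argument list at the front.\<close>

lemma computable_var:
  "0 < n \<Longrightarrow> computable n (\<lambda>xs. hd xs)"
  "1 < n \<Longrightarrow> computable n (\<lambda>xs. hd (tl xs))"
  "2 < n \<Longrightarrow> computable n (\<lambda>xs. hd (tl (tl xs)))"
  "3 < n \<Longrightarrow> computable n (\<lambda>xs. hd (tl (tl (tl xs))))"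
  "4 < n \<Longrightarrow> computable n (\<lambda>xs. hd (tl (tl (tl (tl xs)))))"
  "5 < n \<Longrightarrow> computable n (\<lambda>xs. hd (tl (tl (tl (tl (tl xs))))))"
  "6 < n \<Longrightarrow> computable n (\<lambda>xs. hd (tl (tl (tl (tl (tl (tl xs)))))))"
  "7 < n \<Longrightarrow> computable n (\<lambda>xs. hd (tl (tl (tl (tl (tl (tl (tl xs))))))))"
  "8 < n \<Longrightarrow> computable n (\<lambda>xs. hd (tl (tl (tl (tl (tl (tl (tl (tl xs)))))))))"
  "9 < n \<Longrightarrow> computable n (\<lambda>xs. hd (tl (tl (tl (tl (tl (tl (tl (tl (tl xs))))))))))"
  "10 < n \<Longrightarrow> computable n (\<lambda>xs. hd (tl (tl (tl (tl (tl (tl (tl (tl (tl (tl xs)))))))))))"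
  "11 < n \<Longrightarrow> computable n (\<lambda>xs. hd (tl (tl (tl (tl (tl (tl (tl (tl (tl (tl (tl xs))))))))))))"
  using computable_hd_tl[of 0] computable_hd_tl[of 1] computable_hd_tl[of 2] computable_hd_tl[of 3] computable_hd_tl[of 4] computable_hd_tl[of 5] computable_hd_tl[of 6] computable_hd_tl[of 7] computable_hd_tl[of 8] computable_hd_tl[of 9] computable_hd_tl[of 10] computable_hd_tl[of 11]
  by (simp_all add: numeral_eq_Suc)

section \<open>Primitive recursive arithmetic\<close>

lemma computable_Suc: "computable n f \<Longrightarrow> computable n (\<lambda>xs. Suc (f xs))"
proof (rule computable_comp1[where F = Suc])
  have "rec_eval RSucc xs (Suc (hd xs))" if "length xs = 1" for xs
    using that by (cases xs) (auto intro: rec_eval.succ)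
  then show "computable 1 (\<lambda>xs. Suc (hd xs))"
    unfolding computable_def by blast
qed

lemma computable_const: "computable n (\<lambda>xs. c)"
proof (induction c)
  case 0
  show ?case unfolding computable_def using rec_eval.zero by blast
qed (rule computable_Suc)

lemma computable_add:
  assumes "computable n f" "computable n g"
  shows "computable n (\<lambda>xs. f xs + g xs)"
proof (rule computable_comp2[OF _ assms, where F = "(+)"])
  have "computable (Suc 1) (\<lambda>xs. rec_nat (hd (tl xs)) (\<lambda>k y. Suc (hd (tl (k # y # tl xs)))) (hd xs))"
    by (rule computable_prim[where f = hd and g = "\<lambda>xs. Suc (hd (tl xs))"])
      (auto intro!: computable_var computable_Suc)
  moreover have "rec_nat b (\<lambda>k y. Suc y) a = a + b" for a b by (induction a) auto
  ultimately show "computable 2 (\<lambda>xs. hd xs + hd (tl xs))" by (simp add: numeral_2_eq_2)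
qed

lemma computable_mult:
  assumes "computable n f" "computable n g"
  shows "computable n (\<lambda>xs. f xs * g xs)"
proof (rule computable_comp2[OF _ assms, where F = "(*)"])
  have "computable (Suc 1) (\<lambda>xs. rec_nat ((\<lambda>xs. 0) (tl xs))
      (\<lambda>k y. (\<lambda>xs. hd (tl xs) + hd (tl (tl xs))) (k # y # tl xs)) (hd xs))"
    by (rule computable_prim) (auto intro!: computable_var computable_add computable_const)
  moreover have "rec_nat 0 (\<lambda>k y. y + b) a = a * b" for a b :: nat by (induction a) auto
  ultimately show "computable 2 (\<lambda>xs. hd xs * hd (tl xs))" by (simp add: numeral_2_eq_2)
qed

lemma computable_power:
  assumes "computable n f" "computable n g"
  shows "computable n (\<lambda>xs. f xs ^ g xs)"
\<comment> \<open>\<open>RPrim\<close> recurses on the head of the list, so the exponent has to come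
  first.\<close>
proof (rule computable_comp2[OF _ assms(2,1), where F = "\<lambda>a b. b ^ a"])
  have "computable (Suc 1) (\<lambda>xs. rec_nat ((\<lambda>xs. 1) (tl xs))
      (\<lambda>k y. (\<lambda>xs. hd (tl xs) * hd (tl (tl xs))) (k # y # tl xs)) (hd xs))"
    by (rule computable_prim) (auto intro!: computable_var computable_mult computable_const)
  moreover have "rec_nat 1 (\<lambda>k y. y * b) a = b ^ a" for a b :: nat by (induction a) auto
  ultimately show "computable 2 (\<lambda>xs. hd (tl xs) ^ hd xs)" by (simp add: numeral_2_eq_2)
qed

lemma computable_diff:
  assumes "computable n f" "computable n g"
  shows "computable n (\<lambda>xs. f xs - g xs)"
proof (rule computable_comp2[OF _ assms(2,1), where F = "\<lambda>a b. b - a"])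
  \<comment> \<open>The predecessor is the recursion that returns its counter; iterating it gives
    truncated subtraction.\<close>
  have "computable (Suc 0) (\<lambda>xs. rec_nat ((\<lambda>xs. 0) (tl xs))
      (\<lambda>k y. (\<lambda>xs. hd xs) (k # y # tl xs)) (hd xs))"
    by (rule computable_prim) (auto intro!: computable_var computable_const)
  moreover have "rec_nat 0 (\<lambda>k y. k) a = a - 1" for a :: nat by (cases a) auto
  ultimately have pred: "computable 1 (\<lambda>xs. hd xs - 1)" by simp
  have "computable (Suc 1) (\<lambda>xs. rec_nat ((\<lambda>xs. hd xs) (tl xs))
      (\<lambda>k y. (\<lambda>xs. hd (tl xs) - 1) (k # y # tl xs)) (hd xs))"
    by (rule computable_prim) (intro computable_var computable_comp1[OF pred]; simp)+
  moreover have "rec_nat b (\<lambda>k y. y - Suc 0) a = b - a" for a b :: nat by (induction a) auto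
  ultimately show "computable 2 (\<lambda>xs. hd (tl xs) - hd xs)" by (simp add: numeral_2_eq_2)
qed

section \<open>Decidable predicates and bounded quantification\<close>

lemma decidable_cong:
  assumes "decidable n P" and "\<And>xs. length xs = n \<Longrightarrow> P xs = Q xs"
  shows "decidable n Q"
  using assms computable_cong unfolding decidable_def by force

text \<open>With truncated subtraction, \<open>1 - (a - b)\<close> is the characteristic function of
  a \<le> b.\<close>

lemma decidable_le:
  assumes "computable n f" "computable n g"
  shows "decidable n (\<lambda>xs. f xs \<le> g xs)"
  unfolding decidable_def
  by (rule computable_cong[OF computable_diff[OF computable_const[of n 1] computable_diff[OF assms]]]) auto

lemma decidable_not:
  assumes "decidable n P"
  shows "decidable n (\<lambda>xs. \<not> P xs)"
  using computable_diff[OF computable_const[of n 1] assms[unfolded decidable_def]]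
  unfolding decidable_def by (rule computable_cong) auto

lemma decidable_conj:
  assumes "decidable n P" "decidable n Q"
  shows "decidable n (\<lambda>xs. P xs \<and> Q xs)"
  using computable_mult[OF assms[unfolded decidable_def]]
  unfolding decidable_def by (rule computable_cong) auto

lemma decidable_less:
  assumes "computable n f" "computable n g"
  shows "decidable n (\<lambda>xs. f xs < g xs)"
  using decidable_not[OF decidable_le[OF assms(2,1)]] by (simp add: not_le)

lemma decidable_disj:
  assumes "decidable n P" "decidable n Q"
  shows "decidable n (\<lambda>xs. P xs \<or> Q xs)"
  using decidable_not[OF decidable_conj[OF assms[THEN decidable_not]]] by simp

lemma decidable_imp:
  assumes "decidable n P" "decidable n Q"
  shows "decidable n (\<lambda>xs. P xs \<longrightarrow> Q xs)"
proof -
  have "decidable n (\<lambda>xs. \<not> P xs \<or> Q xs)"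
    by (rule decidable_disj[OF decidable_not[OF assms(1)] assms(2)])
  then show ?thesis by (rule decidable_cong) auto
qed

lemma decidable_eq:
  assumes "computable n f" "computable n g"
  shows "decidable n (\<lambda>xs. f xs = g xs)"
proof -
  have "decidable n (\<lambda>xs. f xs \<le> g xs \<and> g xs \<le> f xs)"
    by (intro decidable_conj decidable_le assms)
  then show ?thesis by (rule decidable_cong) auto
qed

text \<open>Bounded search is a primitive recursion on the bound whose value is a flag that stays 1
  once a witness has been met. The quantified variable becomes the new head, so quantifiers can be
  nested.\<close>

lemma decidable_ex_less:
  assumes b: "computable n b" and P: "decidable (Suc n) (\<lambda>zs. P (hd zs) (tl zs))"
  shows "decidable n (\<lambda>xs. \<exists>y<b xs. P y xs)"
proof -
  let ?g = "\<lambda>zs. if P (hd zs) (tl zs) then 1 else 0 :: nat"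
  have g: "computable (Suc n) ?g" using P unfolding decidable_def .
  \<comment> \<open>The step function of the recursion also receives the previous flag as second
    entry; \<open>sel\<close> removes it before \<open>P\<close> is evaluated.\<close>
  define sel where "sel = (\<lambda>xs::nat list. hd xs) # map (\<lambda>i xs. xs ! Suc (Suc i)) [0..<n]"
  have drop: "map (\<lambda>i. xs ! Suc (Suc i)) [0..<n] = tl (tl xs)" if "length xs = Suc (Suc n)" for xs :: "nat list"
    by (rule nth_equalityI) (use that in \<open>auto simp: nth_tl\<close>)
  have "computable (Suc (Suc n)) (\<lambda>xs. ?g (map (\<lambda>f. f xs) sel))"
    by (rule computable_comp[OF g])
      (auto simp: sel_def intro!: computable_var computable_nth)
  then have g': "computable (Suc (Suc n)) (\<lambda>xs. if P (hd xs) (tl (tl xs)) then 1 else 0)"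
    by (rule computable_cong) (simp add: sel_def comp_def drop)
  have "decidable (Suc (Suc n)) (\<lambda>xs. P (hd xs) (tl (tl xs)) \<or> 0 < hd (tl xs))"
    by (intro decidable_disj g'[folded decidable_def] decidable_less computable_var computable_const) auto
  then have "computable (Suc (Suc n)) (\<lambda>xs. if P (hd xs) (tl (tl xs)) \<or> 0 < hd (tl xs) then 1 else 0)"
    unfolding decidable_def .
  from computable_prim[OF computable_const[of n 0] this]
  have step: "computable (Suc n) (\<lambda>xs. rec_nat 0 (\<lambda>k y. if P k (tl xs) \<or> 0 < y then 1 else 0) (hd xs))"
    by simp
  have eq: "rec_nat 0 (\<lambda>k y. if P k xs \<or> 0 < y then 1 else 0) a = (if \<exists>y<a. P y xs then 1 else 0 :: nat)"
    for a xs by (induction a) (auto simp: less_Suc_eq)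
  have "computable n (\<lambda>xs. (\<lambda>xs. if \<exists>y<hd xs. P y (tl xs) then 1 else 0)
      (map (\<lambda>f. f xs) (b # map (\<lambda>i xs. xs ! i) [0..<n])))"
    by (rule computable_comp[OF step[unfolded eq]]) (auto intro!: b computable_nth)
  moreover have "map ((!) xs) [0..<n] = xs" if "length xs = n" for xs :: "nat list"
    using that map_nth by blast
  ultimately show ?thesis unfolding decidable_def
    by (elim computable_cong) (simp add: comp_def)
qed

lemma decidable_all_less:
  assumes "computable n b" and "decidable (Suc n) (\<lambda>zs. P (hd zs) (tl zs))"
  shows "decidable n (\<lambda>xs. \<forall>y<b xs. P y xs)"
  using decidable_not[OF decidable_ex_less[OF assms(1) decidable_not[OF assms(2)]]] by simp

lemma decidable_ex_le:
  assumes "computable n b" and "decidable (Suc n) (\<lambda>zs. P (hd zs) (tl zs))"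
  shows "decidable n (\<lambda>xs. \<exists>y\<le>b xs. P y xs)"
  using decidable_ex_less[OF computable_Suc[OF assms(1)] assms(2)] by (simp add: less_Suc_eq_le)

lemma decidable_all_le:
  assumes "computable n b" and "decidable (Suc n) (\<lambda>zs. P (hd zs) (tl zs))"
  shows "decidable n (\<lambda>xs. \<forall>y\<le>b xs. P y xs)"
  using decidable_all_less[OF computable_Suc[OF assms(1)] assms(2)] by (simp add: less_Suc_eq_le)

section \<open>Cantor pairing and binary codes of finite sets\<close>

lemma computable_prod_encode:
  assumes "computable n f" "computable n g"
  shows "computable n (\<lambda>xs. prod_encode (f xs, g xs))"
proof -
  have "computable (Suc 0) (\<lambda>xs. rec_nat ((\<lambda>xs. 0) (tl xs))
      (\<lambda>k y. (\<lambda>xs. hd (tl xs) + Suc (hd xs)) (k # y # tl xs)) (hd xs))"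
    by (rule computable_prim) (auto intro!: computable_var computable_const computable_add computable_Suc)
  moreover have "rec_nat 0 (\<lambda>k y. y + Suc k) a = triangle a" for a :: nat by (induction a) auto
  ultimately have "computable 1 (\<lambda>xs. triangle (hd xs))" by simp
  from computable_add[OF computable_comp1[OF this computable_add[OF assms]] assms(1)]
  show ?thesis by (simp add: prod_encode_def)
qed

text \<open>Bit i of r without division: r splits into the digits above i, the digit 1 at i and a
  remainder b below \<open>2 ^ i\<close>. All quantifiers are bounded, the one for a by r
  itself.\<close>

lemma mem_set_decode_iff: "i \<in> set_decode r \<longleftrightarrow> (\<exists>a\<le>r. \<exists>b<2 ^ i. r = (2 * a + 1) * 2 ^ i + b)"
proof
  assume "i \<in> set_decode r"
  then have "odd (r div 2 ^ i)" by (simp add: set_decode_def)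
  then obtain a where a: "r div 2 ^ i = 2 * a + 1" by (elim oddE)
  have "a \<le> r" using a div_le_dividend[of r "2 ^ i"] by linarith
  moreover have "r = (2 * a + 1) * 2 ^ i + r mod 2 ^ i" using div_mult_mod_eq[of r "2 ^ i"] a by simp
  moreover have "r mod 2 ^ i < 2 ^ i" by simp
  ultimately show "\<exists>a\<le>r. \<exists>b<2 ^ i. r = (2 * a + 1) * 2 ^ i + b" by blast
next
  assume "\<exists>a\<le>r. \<exists>b<2 ^ i. r = (2 * a + 1) * 2 ^ i + b"
  then obtain a b where r: "r = b + (2 * a + 1) * 2 ^ i" and "b < 2 ^ i" by (metis add.commute)
  have "r div 2 ^ i = 2 * a + 1" unfolding r using \<open>b < 2 ^ i\<close> by (subst div_mult_self1) auto
  then show "i \<in> set_decode r" by (simp add: set_decode_def)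
qed

lemma decidable_mem_set_decode:
  assumes "computable n f" "computable n g"
  shows "decidable n (\<lambda>xs. f xs \<in> set_decode (g xs))"
proof -
  have "decidable 2 (\<lambda>xs. \<exists>a\<le>hd (tl xs). \<exists>b<2 ^ hd xs. hd (tl xs) = (2 * a + 1) * 2 ^ hd xs + b)"
    by (intro decidable_ex_le decidable_ex_less decidable_eq computable_add computable_mult
        computable_power computable_const computable_var) auto
  then have "computable 2 (\<lambda>xs. if hd xs \<in> set_decode (hd (tl xs)) then 1 else 0)"
    unfolding decidable_def mem_set_decode_iff .
  from computable_comp2[OF this assms] show ?thesis unfolding decidable_def .
qed

lemmas computability_intros =
  decidable_conj decidable_disj decidable_imp decidable_not decidable_eq decidable_le decidable_less
  decidable_ex_le decidable_ex_less decidable_all_le decidable_all_less decidable_mem_set_decode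
  computable_prod_encode computable_power computable_mult computable_add computable_Suc
  computable_const computable_var

section \<open>Time warps and their residuals\<close>

lemma disjCI_right: "(\<not> P \<Longrightarrow> Q) \<Longrightarrow> P \<or> Q"
  by blast

lemma time_warpsI:
  assumes "mono f" "f 0 = 0" "f \<infinity> \<le> (SUP n. f (enat n))"
  shows "f \<in> time_warps"
proof -
  have "(SUP n. f (enat n)) \<le> f \<infinity>" by (rule SUP_least) (simp add: monoD[OF assms(1)])
  with assms show ?thesis by (auto simp: time_warps_def)
qed

lemma tw_mono: "f \<in> time_warps \<Longrightarrow> x \<le> y \<Longrightarrow> f x \<le> f y"
  by (auto simp: time_warps_def dest: monoD)

lemma tw_zero: "f \<in> time_warps \<Longrightarrow> f 0 = 0"
  by (simp add: time_warps_def)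

lemma tw_infinity: "f \<in> time_warps \<Longrightarrow> f \<infinity> = (SUP n. f (enat n))"
  by (simp add: time_warps_def)

lemma tw_infinity_le_iff: "f \<in> time_warps \<Longrightarrow> f \<infinity> \<le> a \<longleftrightarrow> (\<forall>n. f (enat n) \<le> a)"
  by (simp add: tw_infinity SUP_le_iff)

text \<open>A finite value is compact: when it lies below the supremum of the chain, some member
  already reaches it. The free lower bound \<open>N\<close> serves to pick a positive
  argument.\<close>

lemma tw_reaches:
  assumes f: "f \<in> time_warps" and "enat k \<le> f \<infinity>"
  obtains n where "enat k \<le> f (enat n)" "N < n"
proof -
  have "\<exists>n. enat k \<le> f (enat n)"
  proof (cases k)
    case 0
    then show ?thesis by (simp flip: zero_enat_def)
  next
    case (Suc j)
    then have "enat j < (SUP n. f (enat n))"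
      using assms by (metis tw_infinity enat_ord_simps(2) lessI less_le_trans)
    then obtain n where "enat j < f (enat n)" by (auto simp: less_SUP_iff)
    then show ?thesis using Suc by (metis Suc_ile_eq)
  qed
  then obtain n where "enat k \<le> f (enat n)" ..
  also have "\<dots> \<le> f (enat (n + Suc N))" by (rule tw_mono[OF f]) simp
  finally show ?thesis using that by simp
qed

lemma tw_infinity_eq:
  assumes f: "f \<in> time_warps" and "\<And>m. N \<le> m \<Longrightarrow> f (enat m) = c"
  shows "f \<infinity> = c"
proof (rule antisym)
  show "f \<infinity> \<le> c" unfolding tw_infinity_le_iff[OF f]
  proof
    fix n
    have "f (enat n) \<le> f (enat (n + N))" by (rule tw_mono[OF f]) simp
    then show "f (enat n) \<le> c" using assms(2)[of "n + N"] by simp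
  qed
  show "c \<le> f \<infinity>" using assms(2)[of N] tw_mono[OF f, of "enat N" \<infinity>] by simp
qed

text \<open>A time warp either attains its value at infinity at a finite point or is unbounded in the
  following sense (see \<open>tw_attained\<close>).\<close>

definition finite_valued :: "(enat \<Rightarrow> enat) \<Rightarrow> bool" where
  "finite_valued f \<longleftrightarrow> (\<forall>n. f (enat n) \<noteq> \<infinity>)"

definition unbounded :: "(enat \<Rightarrow> enat) \<Rightarrow> bool" where
  "unbounded f \<longleftrightarrow> f \<infinity> = \<infinity> \<and> finite_valued f"

lemma finite_valuedD: "finite_valued f \<Longrightarrow> x \<noteq> \<infinity> \<Longrightarrow> f x < \<infinity>"
  by (auto simp: finite_valued_def)

lemma finite_valued_bounded: "f \<in> time_warps \<Longrightarrow> f \<infinity> < \<infinity> \<Longrightarrow> finite_valued f"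
  unfolding finite_valued_def by (metis enat_ord_code(3) leD tw_mono)

text \<open>In the extended naturals a finite supremum is always attained; an infinite one is
  attained exactly when some finite point already has the value infinity.\<close>

lemma tw_attained:
  assumes f: "f \<in> time_warps" and "\<not> unbounded f"
  obtains N where "\<And>m. N \<le> m \<Longrightarrow> f (enat m) = f \<infinity>"
proof -
  have "\<exists>N. f \<infinity> \<le> f (enat N)"
  proof (cases "f \<infinity>")
    case (enat k)
    then show ?thesis using tw_reaches[OF f, of k] by (metis order_refl)
  next
    case infinity
    then have "\<not> finite_valued f" using assms by (simp add: unbounded_def)
    then show ?thesis by (metis finite_valued_def infinity order_refl)
  qed
  then obtain N where N: "f \<infinity> \<le> f (enat N)" ..
  have "f (enat m) = f \<infinity>" if "N \<le> m" for m
    using N that tw_mono[OF f, of "enat N" "enat m"] tw_mono[OF f, of "enat m" \<infinity>] by simp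
  then show ?thesis using that by blast
qed

section \<open>Finite values and closure under the operations\<close>

lemma finite_valued_inf:
  assumes "f \<in> time_warps" "g \<in> time_warps"
  shows "finite_valued (inf f g) \<longleftrightarrow> finite_valued f \<or> finite_valued g"
proof
  show "finite_valued f \<or> finite_valued g" if "finite_valued (inf f g)"
  proof (rule ccontr)
    assume "\<not> (finite_valued f \<or> finite_valued g)"
    then obtain m n where "f (enat m) = \<infinity>" "g (enat n) = \<infinity>" by (auto simp: finite_valued_def)
    \<comment> \<open>Both functions keep the value infinity beyond the point where they reach it,
      so m + n serves for both.\<close>
    then have "f (enat (m + n)) = \<infinity>" "g (enat (m + n)) = \<infinity>"
      using assms tw_mono[of f "enat m" "enat (m + n)"] tw_mono[of g "enat n" "enat (m + n)"] by simp_all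
    then have "inf f g (enat (m + n)) = \<infinity>" by simp
    then show False using that by (metis finite_valued_def)
  qed
next
  show "finite_valued (inf f g)" if "finite_valued f \<or> finite_valued g"
    unfolding finite_valued_def
  proof
    fix n
    have "f (enat n) < \<infinity> \<or> g (enat n) < \<infinity>" using that by (auto simp: finite_valued_def)
    then have "inf f g (enat n) < \<infinity>" by (simp add: inf_min min_less_iff_disj del: enat_ord_simps(4) not_infinity_eq)
    then show "inf f g (enat n) \<noteq> \<infinity>" by (rule less_imp_neq)
  qed
qed

lemma finite_valued_sup:
  "finite_valued (sup f g) \<longleftrightarrow> finite_valued f \<and> finite_valued g"
proof -
  have "sup a b = \<infinity> \<longleftrightarrow> a = \<infinity> \<or> b = \<infinity>" for a b :: enat
    by (cases "a \<le> b") (auto simp: sup.absorb1 sup.absorb2)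
  then show ?thesis by (auto simp: finite_valued_def simp del: not_infinity_eq)
qed

text \<open>Continuity survives because a finite number below both suprema is reached by both
  functions at a common point.\<close>

lemma time_warps_inf:
  assumes f: "f \<in> time_warps" and g: "g \<in> time_warps"
  shows "inf f g \<in> time_warps"
proof (rule time_warpsI)
  show "mono (inf f g)" unfolding mono_def inf_fun_def by (blast intro: inf_mono tw_mono[OF f] tw_mono[OF g])
  show "inf f g 0 = 0" using f g by (simp add: tw_zero)
  show "inf f g \<infinity> \<le> (SUP n. inf f g (enat n))"
  proof (rule ccontr)
    assume "\<not> ?thesis"
    then have less: "(SUP n. inf f g (enat n)) < inf f g \<infinity>" by simp
    then obtain k where k: "(SUP n. inf f g (enat n)) = enat k" by (cases "SUP n. inf f g (enat n)") auto
    then have "enat k < min (f \<infinity>) (g \<infinity>)" using less by (simp add: inf_min)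
    then have "enat (Suc k) \<le> f \<infinity>" "enat (Suc k) \<le> g \<infinity>" by (simp_all add: Suc_ile_eq)
    then obtain m n where "enat (Suc k) \<le> f (enat m)" "enat (Suc k) \<le> g (enat n)"
      using tw_reaches f g by metis
    then have "enat (Suc k) \<le> f (enat (m + n))" "enat (Suc k) \<le> g (enat (m + n))"
      using tw_mono[OF f, of "enat m" "enat (m + n)"] tw_mono[OF g, of "enat n" "enat (m + n)"] by auto
    then have "enat (Suc k) \<le> inf f g (enat (m + n))" by simp
    also have "\<dots> \<le> (SUP n. inf f g (enat n))" by (rule SUP_upper) simp
    finally show False using k by simp
  qed
qed

lemma time_warps_sup:
  assumes f: "f \<in> time_warps" and g: "g \<in> time_warps"
  shows "sup f g \<in> time_warps"
proof (rule time_warpsI)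
  show "mono (sup f g)" unfolding mono_def sup_fun_def by (blast intro: sup_mono tw_mono[OF f] tw_mono[OF g])
  show "sup f g 0 = 0" using f g by (simp add: tw_zero)
  show "sup f g \<infinity> \<le> (SUP n. sup f g (enat n))"
    by (simp add: tw_infinity[OF f] tw_infinity[OF g] SUP_sup_distrib)
qed

text \<open>Either the values of \<open>g\<close> are cofinal in the finite numbers, so that the
  composite climbs through the supremum defining \<open>f\<close> at infinity, or \<open>g\<close>
  attains its supremum and so does the composite.\<close>

lemma time_warps_comp:
  assumes f: "f \<in> time_warps" and g: "g \<in> time_warps"
  shows "f \<circ> g \<in> time_warps"
proof (rule time_warpsI)
  show "mono (f \<circ> g)" by (simp add: mono_def tw_mono[OF f] tw_mono[OF g])
  show "(f \<circ> g) 0 = 0" using f g by (simp add: tw_zero)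
  show "(f \<circ> g) \<infinity> \<le> (SUP n. (f \<circ> g) (enat n))"
  proof (cases "unbounded g")
    case True
    have "f (enat m) \<le> (SUP n. (f \<circ> g) (enat n))" for m
    proof -
      obtain n where "enat m \<le> g (enat n)"
        using True tw_reaches[OF g, of m] by (metis unbounded_def enat_ord_code(3))
      then have "f (enat m) \<le> (f \<circ> g) (enat n)" by (simp add: tw_mono[OF f])
      then show ?thesis by (rule order_trans) (rule SUP_upper, simp)
    qed
    then show ?thesis using True by (simp add: unbounded_def tw_infinity_le_iff[OF f])
  next
    case False
    then obtain N where "g (enat N) = g \<infinity>" using tw_attained[OF g] by blast
    then have "(f \<circ> g) \<infinity> = (f \<circ> g) (enat N)" by simp
    then show ?thesis by (simp only:) (rule SUP_upper, simp)
  qed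
qed

text \<open>If the composite is infinite at infinity but not earlier, \<open>g\<close> cannot attain
  its supremum; being unbounded, it passes every finite point, so \<open>f\<close> has to be finite
  there.\<close>

lemma finite_valued_comp:
  assumes f: "f \<in> time_warps" and g: "g \<in> time_warps"
  shows "finite_valued (f \<circ> g) \<longleftrightarrow> (f \<circ> g) \<infinity> < \<infinity> \<or> finite_valued f \<and> finite_valued g"
proof (intro iffI disjCI_right)
  assume fg: "finite_valued (f \<circ> g)" and "\<not> (f \<circ> g) \<infinity> < \<infinity>"
  then have inf: "f (g \<infinity>) = \<infinity>" by simp
  then have "unbounded g" using tw_attained[OF g] fg by (metis comp_apply finite_valued_def order_refl)
  moreover have "f (enat m) \<noteq> \<infinity>" for m
  proof
    assume m: "f (enat m) = \<infinity>"
    obtain n where "enat m \<le> g (enat n)"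
      using \<open>unbounded g\<close> tw_reaches[OF g, of m] by (metis unbounded_def enat_ord_code(3))
    then have "f (g (enat n)) = \<infinity>" using m tw_mono[OF f] by (metis enat_ord_simps(5))
    then show False using fg by (metis comp_apply finite_valued_def)
  qed
  ultimately show "finite_valued f \<and> finite_valued g" by (simp add: unbounded_def finite_valued_def)
next
  assume "(f \<circ> g) \<infinity> < \<infinity> \<or> finite_valued f \<and> finite_valued g"
  then show "finite_valued (f \<circ> g)"
  proof
    assume "finite_valued f \<and> finite_valued g"
    then show ?thesis unfolding finite_valued_def by (metis comp_apply enat.exhaust)
  qed (rule finite_valued_bounded[OF time_warps_comp[OF f g]])
qed

lemma time_warps_id: "id \<in> time_warps"
proof (rule time_warpsI)
  have "(SUP n. enat n) = \<infinity>" by (metis SUP_upper UNIV_I enat_ord_simps(2) lessI linorder_not_le enat.exhaust)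
  then show "id \<infinity> \<le> (SUP n. id (enat n))" by simp
qed (auto intro: monoI)

lemma time_warps_bot: "tw_bot \<in> time_warps"
  by (rule time_warpsI) (auto simp: tw_bot_def intro: monoI)

lemma time_warps_top: "tw_top \<in> time_warps"
proof (rule time_warpsI)
  have "tw_top (enat 1) \<le> (SUP n. tw_top (enat n))" by (rule SUP_upper) simp
  then show "tw_top \<infinity> \<le> (SUP n. tw_top (enat n))" by (simp add: tw_top_def zero_enat_def)
qed (auto simp: tw_top_def mono_def)

text \<open>The residuals are computed pointwise at finite points; at infinity the pointwise value may be
  too large and has to be replaced by the supremum.\<close>

definition continuous_part :: "(enat \<Rightarrow> enat) \<Rightarrow> enat \<Rightarrow> enat" where
  "continuous_part a p = (if p = \<infinity> then SUP n. a (enat n) else a p)"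

lemma time_warps_continuous_part:
  assumes "mono a" "a 0 = 0"
  shows "continuous_part a \<in> time_warps"
proof (rule time_warpsI)
  show "mono (continuous_part a)"
  proof (rule monoI)
    fix x y :: enat
    assume "x \<le> y"
    moreover have "a (enat n) \<le> (SUP n. a (enat n))" for n by (rule SUP_upper) simp
    ultimately show "continuous_part a x \<le> continuous_part a y"
      using monoD[OF assms(1)] by (cases x; cases y) (auto simp: continuous_part_def)
  qed
qed (use assms in \<open>auto simp: continuous_part_def\<close>)

text \<open>The order between time warps is decided at finite points. So for monotone
  \<open>a\<close> with value 0 at 0, \<open>continuous_part a\<close> is the largest time warp
  below \<open>a\<close> at those points.\<close>

lemma le_continuous_part_iff:
  assumes g: "g \<in> time_warps"
  shows "g \<le> continuous_part a \<longleftrightarrow> (\<forall>n. g (enat n) \<le> a (enat n))"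
proof
  assume le: "\<forall>n. g (enat n) \<le> a (enat n)"
  have "g x \<le> continuous_part a x" for x
    using le by (cases x) (auto simp: continuous_part_def tw_infinity[OF g] intro!: SUP_mono)
  then show "g \<le> continuous_part a" by (simp add: le_funI)
next
  assume "g \<le> continuous_part a"
  then show "\<forall>n. g (enat n) \<le> a (enat n)"
    by (metis continuous_part_def enat.distinct(1) le_funD)
qed

text \<open>A finite supremum of the set is a member, and an infinite one is handled by continuity.
  Hence the set has a maximum and \<open>f\<close> has a right adjoint.\<close>

lemma tw_Sup_le:
  assumes f: "f \<in> time_warps"
  shows "f (Sup {x. f x \<le> c}) \<le> c"
proof -
  have below: "f x \<le> c" if less: "x < Sup {x. f x \<le> c}" for x
  proof -
    obtain y where "f y \<le> c" "x < y" using less by (auto simp: less_Sup_iff)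
    then show ?thesis using tw_mono[OF f, of x y] by (metis less_imp_le order_trans)
  qed
  show ?thesis
  proof (cases "Sup {x. f x \<le> c}")
    case infinity
    then show ?thesis using below by (simp add: tw_infinity_le_iff[OF f])
  next
    case (enat k)
    show ?thesis
    proof (cases k)
      case 0
      then show ?thesis using enat f by (simp add: tw_zero flip: zero_enat_def)
    next
      case (Suc j)
      have "enat j < Sup {x. f x \<le> c}" using enat Suc by simp
      then obtain y where "f y \<le> c" "enat j < y" by (auto simp: less_Sup_iff)
      then have "enat k \<le> y" using Suc by (simp add: Suc_ile_eq)
      then show ?thesis using enat \<open>f y \<le> c\<close> tw_mono[OF f, of "enat k" y] by simp
    qed
  qed
qed

lemma tw_le_Sup_iff:
  assumes f: "f \<in> time_warps"
  shows "x \<le> Sup {x. f x \<le> c} \<longleftrightarrow> f x \<le> c"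
  using tw_Sup_le[OF f, of c] tw_mono[OF f] by (auto intro: Sup_upper order_trans)

text \<open>The right adjoint of \<open>f\<close> applied to \<open>h p\<close> solves the
  inequality pointwise. The point 0 is treated apart because \<open>f\<close> may vanish beyond 0,
  whereas a time warp fixes 0.\<close>

lemma tw_ldiv_eq:
  assumes f: "f \<in> time_warps" and h: "h \<in> time_warps"
  shows "tw_ldiv f h = continuous_part (\<lambda>p. if p = 0 then 0 else Sup {x. f x \<le> h p})" (is "_ = ?r")
    and "tw_ldiv f h \<in> time_warps"
proof -
  have r: "?r \<in> time_warps"
  proof (rule time_warps_continuous_part)
    show "mono (\<lambda>p. if p = 0 then 0 else Sup {x. f x \<le> h p})"
      by (auto intro!: monoI Sup_subset_mono intro: order_trans[OF _ tw_mono[OF h]])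
  qed simp
  have adj: "g \<le> ?r \<longleftrightarrow> f \<circ> g \<le> h" if g: "g \<in> time_warps" for g
  proof -
    have "g \<le> ?r \<longleftrightarrow> (\<forall>n. f (g (enat n)) \<le> h (enat n))"
      unfolding le_continuous_part_iff[OF g]
      using f g by (auto simp: tw_le_Sup_iff tw_zero) (metis le_zero_eq tw_zero zero_le)
    also have "\<dots> \<longleftrightarrow> f \<circ> g \<le> continuous_part h"
      by (simp add: le_continuous_part_iff time_warps_comp f g)
    also have "continuous_part h = h"
      by (auto simp: continuous_part_def tw_infinity[OF h])
    finally show ?thesis .
  qed
  show eq: "tw_ldiv f h = ?r"
    unfolding tw_ldiv_def by (rule the_equality) (use r adj in \<open>auto intro: antisym\<close>)
  show "tw_ldiv f h \<in> time_warps" using r eq by simp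
qed

text \<open>By monotonicity, a bound for \<open>f\<close> at \<open>g y\<close> is a bound at every
  p below \<open>g y\<close>, so the residual at p is the infimum of all these bounds. The empty
  infimum makes it infinite above the range of \<open>g\<close>.\<close>

lemma tw_rdiv_eq:
  assumes h: "h \<in> time_warps" and g: "g \<in> time_warps"
  shows "tw_rdiv h g = continuous_part (\<lambda>p. if p = 0 then 0 else INF y\<in>{y. p \<le> g y}. h y)" (is "_ = ?r")
    and "tw_rdiv h g \<in> time_warps"
proof -
  have r: "?r \<in> time_warps"
  proof (rule time_warps_continuous_part)
    show "mono (\<lambda>p. if p = 0 then 0 else INF y\<in>{y. p \<le> g y}. h y)"
      by (auto intro!: monoI INF_superset_mono intro: order_trans)
  qed simp
  have adj: "f \<le> ?r \<longleftrightarrow> f \<circ> g \<le> h" if f: "f \<in> time_warps" for f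
  proof -
    have "f \<le> ?r \<longleftrightarrow> (\<forall>n y. enat n \<le> g y \<longrightarrow> f (enat n) \<le> h y)"
      unfolding le_continuous_part_iff[OF f]
      using f by (auto simp: le_INF_iff tw_zero) (metis tw_zero zero_le)
    also have "\<dots> \<longleftrightarrow> (\<forall>y. f (g y) \<le> h y)"
    proof (intro iffI allI impI)
      fix y
      assume *: "\<forall>n y. enat n \<le> g y \<longrightarrow> f (enat n) \<le> h y"
      \<comment> \<open>If \<open>g y\<close> is infinity, the finite values of \<open>f\<close>
        control \<open>f (g y)\<close> through continuity.\<close>
      then show "f (g y) \<le> h y" by (cases "g y") (auto simp: tw_infinity_le_iff[OF f])
    next
      fix n y
      assume "\<forall>y. f (g y) \<le> h y" "enat n \<le> g y"
      then show "f (enat n) \<le> h y" using tw_mono[OF f] order_trans by blast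
    qed
    finally show ?thesis by (simp add: le_fun_def)
  qed
  show eq: "tw_rdiv h g = ?r"
    unfolding tw_rdiv_def by (rule the_equality) (use r adj in \<open>auto intro: antisym\<close>)
  show "tw_rdiv h g \<in> time_warps" using r eq by simp
qed

lemma tw_eval_time_warp: "(\<And>i. v i \<in> time_warps) \<Longrightarrow> tw_eval v u \<in> time_warps"
  by (induction u) (simp_all add: time_warps_inf time_warps_sup time_warps_comp tw_ldiv_eq(2)
      tw_rdiv_eq(2) time_warps_id time_warps_bot time_warps_top)

section \<open>Local descriptions of residual values\<close>

lemma le_tw_ldiv_iff:
  assumes "f \<in> time_warps" "h \<in> time_warps" "0 < n"
  shows "x \<le> tw_ldiv f h (enat n) \<longleftrightarrow> f x \<le> h (enat n)"
  using assms by (simp add: tw_ldiv_eq(1) continuous_part_def tw_le_Sup_iff zero_enat_def)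

lemma le_tw_rdiv_iff:
  assumes "h \<in> time_warps" "g \<in> time_warps" "0 < n"
  shows "x \<le> tw_rdiv h g (enat n) \<longleftrightarrow> (\<forall>y. enat n \<le> g y \<longrightarrow> x \<le> h y)"
  using assms by (simp add: tw_rdiv_eq(1) continuous_part_def le_INF_iff zero_enat_def)

context
  fixes f h :: "enat \<Rightarrow> enat"
  assumes f: "f \<in> time_warps" and h: "h \<in> time_warps"
begin

lemma tw_ldiv_finite_eq_iff:
  assumes n: "0 < n"
  shows "tw_ldiv f h (enat n) = q \<longleftrightarrow> f q \<le> h (enat n) \<and> (q \<noteq> \<infinity> \<longrightarrow> h (enat n) < f (eSuc q))"
    (is "?r = q \<longleftrightarrow> _")
proof -
  note galois = le_tw_ldiv_iff[OF f h n]
  show ?thesis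
  proof (intro iffI conjI impI)
    assume q: "?r = q"
    show "f q \<le> h (enat n)" using galois[of q] q by simp
    assume "q \<noteq> \<infinity>"
    then show "h (enat n) < f (eSuc q)" using galois[of "eSuc q"] q by (cases q) (auto simp: eSuc_enat)
  next
    assume q: "f q \<le> h (enat n) \<and> (q \<noteq> \<infinity> \<longrightarrow> h (enat n) < f (eSuc q))"
    have "\<not> q < ?r"
    proof
      assume less: "q < ?r"
      have "q \<noteq> \<infinity>" using less by (metis enat_ord_simps(6))
      with less have "eSuc q \<le> ?r" "q \<noteq> \<infinity>" by (auto simp: ileI1 simp del: not_infinity_eq)
      then show False using q galois[of "eSuc q"] by auto
    qed
    moreover have "q \<le> ?r" using galois q by blast
    ultimately show "?r = q" by simp
  qed
qed

text \<open>If \<open>h\<close> attains its supremum, the residual is eventually constant, so the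
  description at finite points carries over to infinity.\<close>

lemma tw_ldiv_eq_iff:
  assumes "0 < p" and "p \<noteq> \<infinity> \<or> \<not> unbounded h"
  shows "tw_ldiv f h p = q \<longleftrightarrow> f q \<le> h p \<and> (q \<noteq> \<infinity> \<longrightarrow> h p < f (eSuc q))"
proof (cases p)
  case (enat n)
  then show ?thesis using assms tw_ldiv_finite_eq_iff[of n] by (simp add: zero_enat_def)
next
  case infinity
  then obtain N where N: "\<And>m. N \<le> m \<Longrightarrow> h (enat m) = h \<infinity>"
    using assms tw_attained[OF h] by metis
  \<comment> \<open>\<open>Suc N\<close> instead of \<open>N\<close> keeps the argument positive, as
    the description at finite points demands.\<close>
  have "tw_ldiv f h (enat m) = tw_ldiv f h (enat (Suc N))" if "Suc N \<le> m" for m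
  proof -
    have "0 < m" "h (enat m) = h \<infinity>" "h (enat (Suc N)) = h \<infinity>" using that N by auto
    moreover have "f (tw_ldiv f h (enat (Suc N))) \<le> h \<infinity> \<and> (tw_ldiv f h (enat (Suc N)) \<noteq> \<infinity> \<longrightarrow> h \<infinity> < f (eSuc (tw_ldiv f h (enat (Suc N)))))"
      using tw_ldiv_finite_eq_iff[of "Suc N" "tw_ldiv f h (enat (Suc N))"] N[of "Suc N"] by (auto simp del: not_infinity_eq)
    ultimately show ?thesis using tw_ldiv_finite_eq_iff[of m] by simp
  qed
  then have "tw_ldiv f h \<infinity> = tw_ldiv f h (enat (Suc N))"
    by (rule tw_infinity_eq[OF tw_ldiv_eq(2)[OF f h]])
  then show ?thesis using infinity tw_ldiv_finite_eq_iff[of "Suc N"] N[of "Suc N"] by simp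
qed

text \<open>For unbounded \<open>h\<close>, x lies below the residual at some finite point iff
  \<open>h\<close> overtakes \<open>f x\<close>, that is, iff \<open>f x\<close> is finite. So the
  value at infinity is the supremum of the points where \<open>f\<close> is finite, whatever the
  values of \<open>h\<close> are.\<close>

lemma tw_ldiv_infinity_eq_iff:
  assumes unb: "unbounded h"
  shows "tw_ldiv f h \<infinity> = q \<longleftrightarrow>
    q = \<infinity> \<and> finite_valued f \<or> q \<noteq> \<infinity> \<and> f q < \<infinity> \<and> f (eSuc q) = \<infinity>"
proof -
  let ?r = "tw_ldiv f h"
  have r: "?r \<in> time_warps" by (rule tw_ldiv_eq(2)[OF f h])
  have lower: "enat k \<le> ?r \<infinity>" if fin: "f (enat k) < \<infinity>" for k
  proof -
    obtain j where "f (enat k) = enat j" using fin less_infinityE by blast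
    moreover obtain n where "enat j \<le> h (enat n)" "0 < n"
      using tw_reaches[OF h, of j 0] unb by (metis unbounded_def enat_ord_code(3))
    ultimately have "enat k \<le> ?r (enat n)" by (simp add: le_tw_ldiv_iff[OF f h])
    also have "\<dots> \<le> ?r \<infinity>" by (rule tw_mono[OF r]) simp
    finally show ?thesis .
  qed
  have upper: "?r \<infinity> \<le> enat k" if "f (enat (Suc k)) = \<infinity>" for k
    unfolding tw_infinity_le_iff[OF r]
  proof
    fix n
    show "?r (enat n) \<le> enat k"
    proof (cases "n = 0")
      case True
      then show ?thesis using tw_zero[OF r] by (simp flip: zero_enat_def)
    next
      case False
      show ?thesis
      proof (rule ccontr)
        assume "\<not> ?r (enat n) \<le> enat k"
        then have "enat (Suc k) \<le> ?r (enat n)" by (simp add: Suc_ile_eq)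
        then have "h (enat n) = \<infinity>" using False that by (simp add: le_tw_ldiv_iff[OF f h])
        then show False using unb by (metis unbounded_def finite_valued_def)
      qed
    qed
  qed
  have 1: "?r \<infinity> = \<infinity>" if "finite_valued f"
  proof (rule ccontr)
    assume "?r \<infinity> \<noteq> \<infinity>"
    then obtain k where "?r \<infinity> = enat k" by auto
    moreover have "enat (Suc k) \<le> ?r \<infinity>" using that by (intro lower) (simp add: finite_valued_def)
    ultimately show False by simp
  qed
  have 2: "?r \<infinity> = q" if "q \<noteq> \<infinity> \<and> f q < \<infinity> \<and> f (eSuc q) = \<infinity>" for q
    using that lower upper by (cases q) (auto simp: eSuc_enat intro: antisym)
  have 3: "\<exists>q. q \<noteq> \<infinity> \<and> f q < \<infinity> \<and> f (eSuc q) = \<infinity>" if "\<not> finite_valued f"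
  proof -
    define k where "k = (LEAST k. f (enat k) = \<infinity>)"
    have k: "f (enat k) = \<infinity>" unfolding k_def
      by (rule LeastI_ex) (use that in \<open>auto simp: finite_valued_def\<close>)
    then have "k \<noteq> 0" using tw_zero[OF f] by (metis infinity_ne_i0 zero_enat_def)
    then obtain j where j: "k = Suc j" by (cases k) auto
    then have "f (enat j) \<noteq> \<infinity>" using not_less_Least[of j "\<lambda>k. f (enat k) = \<infinity>"] by (simp flip: k_def)
    then show ?thesis using k j by (intro exI[of _ "enat j"]) (simp add: eSuc_enat)
  qed
  show ?thesis
  proof (cases "finite_valued f")
    case True
    have "f x \<noteq> \<infinity>" if "x \<noteq> \<infinity>" for x using True that by (auto simp: finite_valued_def)
    then show ?thesis using 1[OF True] True by (cases q) (auto simp: eSuc_enat)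
  next
    case False
    then obtain q' where q': "q' \<noteq> \<infinity> \<and> f q' < \<infinity> \<and> f (eSuc q') = \<infinity>" using 3 by metis
    show ?thesis
    proof
      assume "?r \<infinity> = q"
      then have "q = q'" using 2[OF q'] by simp
      then show "q = \<infinity> \<and> finite_valued f \<or> q \<noteq> \<infinity> \<and> f q < \<infinity> \<and> f (eSuc q) = \<infinity>"
        using q' by metis
    qed (use 2 False in metis)
  qed
qed

text \<open>By adjunction, the residual is infinite at a positive n iff \<open>f\<close> at infinity
  is at most \<open>h n\<close>. If every \<open>h n\<close> stays strictly below that number but
  the supremum does not, the supremum is not attained and hence infinite.\<close>

lemma finite_valued_tw_ldiv:
  "finite_valued (tw_ldiv f h) \<longleftrightarrow> h \<infinity> < f \<infinity> \<or> f \<infinity> = \<infinity> \<and> finite_valued h"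
proof -
  let ?r = "tw_ldiv f h"
  have "finite_valued ?r \<longleftrightarrow> (\<forall>n>0. h (enat n) < f \<infinity>)"
  proof -
    have "(?r (enat n) = \<infinity>) = (f \<infinity> \<le> h (enat n))" if "0 < n" for n
      using le_tw_ldiv_iff[OF f h that, of \<infinity>] by simp
    moreover have "?r (enat 0) \<noteq> \<infinity>" using tw_zero[OF tw_ldiv_eq(2)[OF f h]] by (simp flip: zero_enat_def)
    ultimately show ?thesis unfolding finite_valued_def by (metis bot_nat_0.not_eq_extremum not_le)
  qed
  also have "\<dots> \<longleftrightarrow> h \<infinity> < f \<infinity> \<or> f \<infinity> = \<infinity> \<and> finite_valued h"
  proof (intro iffI disjCI_right)
    assume le: "\<forall>n>0. h (enat n) < f \<infinity>" and "\<not> h \<infinity> < f \<infinity>"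
    have le': "h (enat n) < f \<infinity>" for n
      using le tw_mono[OF h, of "enat n" "enat (Suc n)"] by (auto intro: le_less_trans)
    then have "h \<infinity> \<noteq> h (enat n)" for n using \<open>\<not> h \<infinity> < f \<infinity>\<close> by metis
    then have "unbounded h" using tw_attained[OF h] by (metis order_refl)
    moreover have "f \<infinity> = \<infinity>"
    proof (rule ccontr)
      assume "f \<infinity> \<noteq> \<infinity>"
      then obtain k where "f \<infinity> = enat k" by auto
      moreover obtain n where "enat k \<le> h (enat n)"
        using tw_reaches[OF h, of k] \<open>unbounded h\<close> by (metis unbounded_def enat_ord_code(3))
      ultimately show False using le' by (metis leD)
    qed
    ultimately show "f \<infinity> = \<infinity> \<and> finite_valued h" by (simp add: unbounded_def)
  next
    assume "h \<infinity> < f \<infinity> \<or> f \<infinity> = \<infinity> \<and> finite_valued h"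
    then show "\<forall>n>0. h (enat n) < f \<infinity>"
      using tw_mono[OF h, of _ \<infinity>] by (auto simp: finite_valued_def intro: le_less_trans)
  qed
  finally show ?thesis .
qed

end

context
  fixes h g :: "enat \<Rightarrow> enat"
  assumes h: "h \<in> time_warps" and g: "g \<in> time_warps"
begin

lemma tw_rdiv_beyond:
  assumes "g \<infinity> < enat m"
  shows "tw_rdiv h g (enat m) = \<infinity>"
proof -
  have "\<not> enat m \<le> g y" for y using assms tw_mono[OF g, of y \<infinity>] by auto
  moreover have "0 < m" using assms by (cases m) (auto simp flip: zero_enat_def)
  ultimately have "\<infinity> \<le> tw_rdiv h g (enat m)" using le_tw_rdiv_iff[OF h g, of m \<infinity>] by blast
  then show ?thesis by simp
qed

text \<open>As \<open>g\<close> crosses m between n and n + 1, the infimum ranges over the points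
  from n + 1 on, and \<open>h\<close> is monotone.\<close>

lemma tw_rdiv_step:
  assumes "g (enat n) < enat m" "enat m \<le> g (enat (Suc n))"
  shows "tw_rdiv h g (enat m) = h (enat (Suc n))"
proof -
  have m: "0 < m" using assms by (cases m) (auto simp flip: zero_enat_def)
  have "enat m \<le> g y \<longleftrightarrow> enat (Suc n) \<le> y" for y
    using assms tw_mono[OF g, of y "enat n"] tw_mono[OF g, of "enat (Suc n)" y]
    by (cases y) (auto simp: not_le[symmetric] not_less_eq_eq intro: order_trans)
  then have "x \<le> tw_rdiv h g (enat m) \<longleftrightarrow> x \<le> h (enat (Suc n))" for x
    using tw_mono[OF h] by (auto simp: le_tw_rdiv_iff[OF h g m] intro: order_trans)
  then show ?thesis by (meson antisym order_refl)
qed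

lemma tw_rdiv_above:
  assumes "g (enat k) < enat m"
  shows "h (enat k) \<le> tw_rdiv h g (enat m)"
proof -
  have m: "0 < m" using assms by (cases m) (auto simp flip: zero_enat_def)
  have "h (enat k) \<le> h y" if "enat m \<le> g y" for y
  proof -
    have "\<not> y \<le> enat k" using assms that tw_mono[OF g, of y "enat k"] by auto
    then show ?thesis by (simp add: tw_mono[OF h])
  qed
  then show ?thesis by (simp add: le_tw_rdiv_iff[OF h g m])
qed

text \<open>A positive p lies above the range of \<open>g\<close>, or it is first reached at a
  successor because \<open>g\<close> vanishes at 0, or it is infinity and only approached in the
  limit.\<close>

lemma tw_rdiv_eq_iff:
  assumes p: "0 < p"
  shows "tw_rdiv h g p = q \<longleftrightarrow> g \<infinity> < p \<and> q = \<infinity>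
    \<or> (\<exists>n. p \<le> g (enat (Suc n)) \<and> g (enat n) < p \<and> q = h (enat (Suc n)))
    \<or> p = \<infinity> \<and> unbounded g \<and> q = h \<infinity>" (is "?r p = q \<longleftrightarrow> ?C q")
proof -
  have r: "?r \<in> time_warps" by (rule tw_rdiv_eq(2)[OF h g])
  have 1: "?r p = \<infinity>" if less: "g \<infinity> < p"
  proof (cases p)
    case (enat m)
    then show ?thesis using less tw_rdiv_beyond by simp
  next
    case infinity
    then obtain k where k: "g \<infinity> = enat k" using less infinity less_infinityE by blast
    have "?r \<infinity> = \<infinity>" by (rule tw_infinity_eq[OF r, of "Suc k"]) (use k tw_rdiv_beyond in auto)
    then show ?thesis using infinity by simp
  qed
  have 2: "?r p = h (enat (Suc n))" if n: "p \<le> g (enat (Suc n))" "g (enat n) < p" for n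
  proof (cases p)
    case (enat m)
    then show ?thesis using n tw_rdiv_step by simp
  next
    case infinity
    \<comment> \<open>\<open>g\<close> jumps to infinity at n + 1, so every finite number above k
      crosses the same step and the residual is eventually constant.\<close>
    then obtain k where k: "g (enat n) = enat k" using n infinity less_infinityE by blast
    have "?r \<infinity> = h (enat (Suc n))"
      by (rule tw_infinity_eq[OF r, of "Suc k"]) (use k infinity n tw_rdiv_step in auto)
    then show ?thesis using infinity by simp
  qed
  have 3: "?r p = h \<infinity>" if unb: "unbounded g" and "p = \<infinity>"
  proof -
    have "?r \<infinity> \<le> h \<infinity>" unfolding tw_infinity_le_iff[OF r]
    proof
      fix m
      obtain n where "enat (Suc m) \<le> g (enat n)"
        using unb tw_reaches[OF g, of "Suc m"] by (metis unbounded_def enat_ord_code(3))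
      then have "?r (enat (Suc m)) \<le> h (enat n)"
        using le_tw_rdiv_iff[OF h g, of "Suc m" "?r (enat (Suc m))"] by simp
      moreover have "?r (enat m) \<le> ?r (enat (Suc m))" by (rule tw_mono[OF r]) simp
      moreover have "h (enat n) \<le> h \<infinity>" by (rule tw_mono[OF h]) simp
      ultimately show "?r (enat m) \<le> h \<infinity>" by order
    qed
    moreover have "h \<infinity> \<le> ?r \<infinity>" unfolding tw_infinity_le_iff[OF h]
    proof
      fix k
      obtain j where "g (enat k) = enat j" using unb by (auto simp: unbounded_def finite_valued_def)
      then have "h (enat k) \<le> ?r (enat (Suc j))" by (intro tw_rdiv_above) simp
      also have "\<dots> \<le> ?r \<infinity>" by (rule tw_mono[OF r]) simp
      finally show "h (enat k) \<le> ?r \<infinity>" .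
    qed
    ultimately show ?thesis using that by simp
  qed
  \<comment> \<open>Each alternative forces the value by 1, 2 and 3, so the converse only needs that
    some alternative holds.\<close>
  have "\<exists>q. ?C q"
  proof (cases "\<exists>n. p \<le> g (enat n)")
    case True
    define k where "k = (LEAST k. p \<le> g (enat k))"
    have k: "p \<le> g (enat k)" unfolding k_def by (rule LeastI_ex[OF True])
    then have "k \<noteq> 0" using tw_zero[OF g] p by (metis le_zero_eq not_gr_zero zero_enat_def)
    then obtain j where j: "k = Suc j" by (cases k) auto
    then have "\<not> p \<le> g (enat j)" using not_less_Least[of j "\<lambda>k. p \<le> g (enat k)"] by (simp flip: k_def)
    then have "?C (h (enat (Suc j)))" using k j by (metis not_le)
    then show ?thesis by blast
  next
    case False
    show ?thesis
    proof (cases "g \<infinity> < p")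
      case not_less: False
      have "unbounded g"
      proof (rule ccontr)
        assume "\<not> unbounded g"
        then obtain N where "g (enat N) = g \<infinity>" using tw_attained[OF g] by blast
        then show False using False not_less by (metis not_le)
      qed
      moreover have "p = \<infinity>"
      proof (rule ccontr)
        assume "p \<noteq> \<infinity>"
        then obtain m where "p = enat m" by auto
        then show False using False not_less tw_reaches[OF g, of m] by (metis not_le)
      qed
      ultimately show ?thesis by blast
    qed blast
  qed
  then show ?thesis using 1 2 3 by auto
qed

text \<open>If the residual becomes infinite only at infinity, two of the three ways to that value
  are excluded, since they already produce it at a finite point. So \<open>g\<close> is unbounded,
  and an infinite value of \<open>h\<close> at a finite point would surface by
  \<open>tw_rdiv_above\<close>.\<close>

lemma finite_valued_tw_rdiv:
  "finite_valued (tw_rdiv h g) \<longleftrightarrow> tw_rdiv h g \<infinity> < \<infinity> \<or> unbounded g \<and> finite_valued h"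
proof (intro iffI disjCI_right)
  let ?r = "tw_rdiv h g"
  assume fin: "finite_valued ?r" and "\<not> ?r \<infinity> < \<infinity>"
  then have "?r \<infinity> = \<infinity>" by simp
  then consider "g \<infinity> < \<infinity>"
    | n where "g (enat (Suc n)) = \<infinity>" "g (enat n) < \<infinity>" "h (enat (Suc n)) = \<infinity>"
    | "unbounded g"
    using tw_rdiv_eq_iff[of \<infinity> \<infinity>] by auto
  then have "unbounded g"
  proof cases
    case 1
    then obtain k where "g \<infinity> = enat k" by auto
    then have "?r (enat (Suc k)) = \<infinity>" by (intro tw_rdiv_beyond) simp
    then show ?thesis using fin by (metis finite_valued_def)
  next
    case 2
    then obtain k where "g (enat n) = enat k" by auto
    then have "?r (enat (Suc k)) = \<infinity>" using tw_rdiv_step[of n "Suc k"] 2 by simp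
    then show ?thesis using fin by (metis finite_valued_def)
  qed
  moreover have "h (enat k) \<noteq> \<infinity>" for k
  proof
    assume "h (enat k) = \<infinity>"
    moreover obtain j where "g (enat k) = enat j"
      using \<open>unbounded g\<close> by (auto simp: unbounded_def finite_valued_def)
    ultimately have "?r (enat (Suc j)) = \<infinity>" using tw_rdiv_above[of k "Suc j"] by simp
    then show False using fin by (metis finite_valued_def)
  qed
  ultimately show "unbounded g \<and> finite_valued h" by (simp add: finite_valued_def)
next
  let ?r = "tw_rdiv h g"
  have r: "?r \<in> time_warps" by (rule tw_rdiv_eq(2)[OF h g])
  assume "?r \<infinity> < \<infinity> \<or> unbounded g \<and> finite_valued h"
  then show "finite_valued ?r"
  proof
    assume *: "unbounded g \<and> finite_valued h"
    have "?r (enat m) \<noteq> \<infinity>" for m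
    proof -
      obtain n where "enat (Suc m) \<le> g (enat n)"
        using * tw_reaches[OF g, of "Suc m"] by (metis unbounded_def enat_ord_code(3))
      then have "?r (enat (Suc m)) \<le> h (enat n)"
        using le_tw_rdiv_iff[OF h g, of "Suc m" "?r (enat (Suc m))"] by simp
      moreover have "?r (enat m) \<le> ?r (enat (Suc m))" by (rule tw_mono[OF r]) simp
      moreover have "h (enat n) \<noteq> \<infinity>" using * by (simp add: finite_valued_def)
      ultimately show ?thesis by (metis enat_ord_simps(5))
    qed
    then show ?thesis by (simp add: finite_valued_def)
  qed (rule finite_valued_bounded[OF r])
qed

end

section \<open>Refuting tables\<close>

text \<open>A table is a relation R, where R u p q states that the term with code u has value q at the
  point p. Points and values range over the numbers up to K, and K itself stands for infinity.\<close>

definition point :: "nat \<Rightarrow> nat \<Rightarrow> enat" where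
  "point K p = (if p < K then enat p else \<infinity>)"

text \<open>The conditions on a compound term are imposed only if the table contains its value at infinity.\<close>

definition active :: "(nat \<Rightarrow> nat \<Rightarrow> nat \<Rightarrow> bool) \<Rightarrow> nat \<Rightarrow> nat \<Rightarrow> bool" where
  "active R K u \<longleftrightarrow> (\<exists>q\<le>K. R u K q)"

definition avoids_top :: "(nat \<Rightarrow> nat \<Rightarrow> nat \<Rightarrow> bool) \<Rightarrow> nat \<Rightarrow> nat \<Rightarrow> bool" where
  "avoids_top R K u \<longleftrightarrow> (\<forall>n<K. \<not> R u n K)"

text \<open>In a consistent table, \<open>avoids_top\<close> and \<open>reaches_top_late\<close> hold iff the warp is
  \<open>finite_valued\<close>, respectively \<open>unbounded\<close>. These are the only global properties of a warp that
  the local conditions below refer to.\<close>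

definition reaches_top_late :: "(nat \<Rightarrow> nat \<Rightarrow> nat \<Rightarrow> bool) \<Rightarrow> nat \<Rightarrow> nat \<Rightarrow> bool" where
  "reaches_top_late R K u \<longleftrightarrow> R u K K \<and> avoids_top R K u"

text \<open>The clause for p = K is continuity: the value at infinity is attained at a finite point
  or approached in the limit. Monotonicity with equal points makes the table single-valued.\<close>

definition var_ok :: "(nat \<Rightarrow> nat \<Rightarrow> nat \<Rightarrow> bool) \<Rightarrow> nat \<Rightarrow> nat \<Rightarrow> bool" where
  "var_ok R K u \<longleftrightarrow>
    (\<forall>p\<le>K. \<forall>q\<le>K. R u p q \<longrightarrow>
      (p = 0 \<longrightarrow> q = 0) \<and>
      (p = K \<longrightarrow> q = K \<and> avoids_top R K u \<or> (\<exists>n<K. R u n q)) \<and>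
      (\<forall>p'\<le>K. \<forall>q'\<le>K. R u p' q' \<longrightarrow> p \<le> p' \<longrightarrow> q \<le> q'))"

text \<open>\<open>avoids_top\<close> records only an absence of samples, so it has to be backed by
  a criterion for finite values, here \<open>finite_valued_inf\<close>. One implication suffices,
  since a sample with value K at a finite point refutes finiteness by itself. The other operations
  are treated alike.\<close>

definition meet_ok :: "(nat \<Rightarrow> nat \<Rightarrow> nat \<Rightarrow> bool) \<Rightarrow> nat \<Rightarrow> nat \<Rightarrow> nat \<Rightarrow> nat \<Rightarrow> bool" where
  "meet_ok R K u x y \<longleftrightarrow>
    (avoids_top R K u \<longrightarrow> avoids_top R K x \<or> avoids_top R K y) \<and>
    (\<forall>p\<le>K. \<forall>q\<le>K. R u p q \<longrightarrow>
      (\<exists>a\<le>K. \<exists>b\<le>K. R x p a \<and> R y p b \<and> (a \<le> b \<and> q = a \<or> b \<le> a \<and> q = b)))"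

definition join_ok :: "(nat \<Rightarrow> nat \<Rightarrow> nat \<Rightarrow> bool) \<Rightarrow> nat \<Rightarrow> nat \<Rightarrow> nat \<Rightarrow> nat \<Rightarrow> bool" where
  "join_ok R K u x y \<longleftrightarrow>
    (avoids_top R K u \<longrightarrow> avoids_top R K x \<and> avoids_top R K y) \<and>
    (\<forall>p\<le>K. \<forall>q\<le>K. R u p q \<longrightarrow>
      (\<exists>a\<le>K. \<exists>b\<le>K. R x p a \<and> R y p b \<and> (a \<le> b \<and> q = b \<or> b \<le> a \<and> q = a)))"

definition comp_ok :: "(nat \<Rightarrow> nat \<Rightarrow> nat \<Rightarrow> bool) \<Rightarrow> nat \<Rightarrow> nat \<Rightarrow> nat \<Rightarrow> nat \<Rightarrow> bool" where
  "comp_ok R K u x y \<longleftrightarrow>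
    (avoids_top R K u \<longrightarrow> (\<exists>q<K. R u K q) \<or> avoids_top R K x \<and> avoids_top R K y) \<and>
    (\<forall>p\<le>K. \<forall>q\<le>K. R u p q \<longrightarrow> (\<exists>a\<le>K. R y p a \<and> R x a q))"

text \<open>The alternatives for positive p are \<open>tw_ldiv_eq_iff\<close> and
  \<open>tw_ldiv_infinity_eq_iff\<close>. \<open>Suc q < K\<close> guarantees that
  \<open>Suc q\<close> denotes the successor of q and not infinity.\<close>

definition ldiv_ok :: "(nat \<Rightarrow> nat \<Rightarrow> nat \<Rightarrow> bool) \<Rightarrow> nat \<Rightarrow> nat \<Rightarrow> nat \<Rightarrow> nat \<Rightarrow> bool" where
  "ldiv_ok R K u x y \<longleftrightarrow>
    (avoids_top R K u \<longrightarrow>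
      (\<exists>a\<le>K. \<exists>b\<le>K. R y K a \<and> R x K b \<and> a < b) \<or> R x K K \<and> avoids_top R K y) \<and>
    (\<forall>p\<le>K. \<forall>q\<le>K. R u p q \<longrightarrow>
      p = 0 \<and> q = 0 \<or>
      0 < p \<and> (p < K \<or> \<not> reaches_top_late R K y) \<and>
        (\<exists>a\<le>K. \<exists>b\<le>K. R y p a \<and> R x q b \<and> b \<le> a \<and>
          (q < K \<longrightarrow> Suc q < K \<and> (\<exists>d\<le>K. R x (Suc q) d \<and> a < d))) \<or>
      p = K \<and> reaches_top_late R K y \<and>
        (q = K \<and> avoids_top R K x \<or> Suc q < K \<and> (\<exists>b<K. R x q b) \<and> R x (Suc q) K))"

text \<open>The alternatives for positive p are those of \<open>tw_rdiv_eq_iff\<close>; samples at n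
  and n + 1 certify the crossing.\<close>

definition rdiv_ok :: "(nat \<Rightarrow> nat \<Rightarrow> nat \<Rightarrow> bool) \<Rightarrow> nat \<Rightarrow> nat \<Rightarrow> nat \<Rightarrow> nat \<Rightarrow> bool" where
  "rdiv_ok R K u x y \<longleftrightarrow>
    (avoids_top R K u \<longrightarrow>
      (\<exists>q<K. R u K q) \<or> reaches_top_late R K y \<and> avoids_top R K x) \<and>
    (\<forall>p\<le>K. \<forall>q\<le>K. R u p q \<longrightarrow>
      p = 0 \<and> q = 0 \<or>
      0 < p \<and> (\<exists>a<p. R y K a) \<and> q = K \<or>
      0 < p \<and> (\<exists>n<K. Suc n < K \<and> (\<exists>a\<le>K. R y (Suc n) a \<and> p \<le> a) \<and> (\<exists>b<p. R y n b) \<and>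
        R x (Suc n) q) \<or>
      0 < p \<and> p = K \<and> reaches_top_late R K y \<and> R x K q)"

text \<open>Quantifying over all codes up to c covers every subterm, since codes of arguments do not
  exceed the code of the term. Identity and bottom are finite-valued in any case; the top warp is
  not, so a table that samples it has to exhibit this.\<close>

definition diagram :: "(nat \<Rightarrow> nat \<Rightarrow> nat \<Rightarrow> bool) \<Rightarrow> nat \<Rightarrow> nat \<Rightarrow> bool" where
  "diagram R K c \<longleftrightarrow>
    (\<forall>i\<le>c. var_ok R K (prod_encode (0, i))) \<and>
    (\<forall>x\<le>c. \<forall>y\<le>c. \<forall>k\<le>5. 0 < k \<and> active R K (prod_encode (k, prod_encode (x, y))) \<longrightarrow>
      active R K x \<and> active R K y \<and>
      (k = 1 \<longrightarrow> meet_ok R K (prod_encode (k, prod_encode (x, y))) x y) \<and>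
      (k = 2 \<longrightarrow> join_ok R K (prod_encode (k, prod_encode (x, y))) x y) \<and>
      (k = 3 \<longrightarrow> comp_ok R K (prod_encode (k, prod_encode (x, y))) x y) \<and>
      (k = 4 \<longrightarrow> ldiv_ok R K (prod_encode (k, prod_encode (x, y))) x y) \<and>
      (k = 5 \<longrightarrow> rdiv_ok R K (prod_encode (k, prod_encode (x, y))) x y)) \<and>
    (\<forall>p\<le>K. \<forall>q\<le>K. R (prod_encode (6, 0)) p q \<longrightarrow> q = p) \<and>
    (\<forall>p\<le>K. \<forall>q\<le>K. R (prod_encode (7, 0)) p q \<longrightarrow> q = 0) \<and>
    (\<forall>p\<le>K. \<forall>q\<le>K. R (prod_encode (8, 0)) p q \<longrightarrow>
      (p = 0 \<and> q = 0 \<or> 0 < p \<and> q = K) \<and> \<not> avoids_top R K (prod_encode (8, 0)))"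

definition refutes :: "(nat \<Rightarrow> nat \<Rightarrow> nat \<Rightarrow> bool) \<Rightarrow> nat \<Rightarrow> nat \<Rightarrow> nat \<Rightarrow> bool" where
  "refutes R K s t \<longleftrightarrow> diagram R K (s + t) \<and> active R K s \<and> active R K t \<and>
    (\<exists>p\<le>K. \<exists>a\<le>K. \<exists>b\<le>K. R s p a \<and> R t p b \<and> a \<noteq> b)"

section \<open>Codes of tables and bounds for the search\<close>

definition coded :: "nat \<Rightarrow> nat \<Rightarrow> nat \<Rightarrow> nat \<Rightarrow> bool" where
  "coded r u p q \<longleftrightarrow> prod_encode (u, prod_encode (p, q)) \<in> set_decode r"

text \<open>Two sample sets with at most \<open>4 * 8 ^ s\<close> and \<open>4 * 8 ^ t\<close>
  elements give at most two numbers per sample, besides 0 and infinity; twice their joint size plus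
  2 is below \<open>64 * 8 ^ (s + t)\<close>.\<close>

definition size_bound :: "nat \<Rightarrow> nat \<Rightarrow> nat" where
  "size_bound s t = 8 ^ (s + t + 2)"

text \<open>A set of numbers up to N is encoded below \<open>2 ^ Suc N\<close>; here N bounds the
  code of a single sample.\<close>

definition code_bound :: "nat \<Rightarrow> nat \<Rightarrow> nat" where
  "code_bound s t =
    2 ^ Suc (prod_encode (s + t, prod_encode (size_bound s t, size_bound s t)))"

lemma computable_size_bound:
  assumes "computable n s" "computable n t"
  shows "computable n (\<lambda>xs. size_bound (s xs) (t xs))"
  unfolding size_bound_def by (intro computability_intros assms)

lemma computable_code_bound:
  assumes "computable n s" "computable n t"
  shows "computable n (\<lambda>xs. code_bound (s xs) (t xs))"
  unfolding code_bound_def by (intro computability_intros computable_size_bound assms)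

lemma decidable_refutable:
  "decidable 2 (\<lambda>xs. \<exists>r<code_bound (hd xs) (hd (tl xs)).
    refutes (coded r) (size_bound (hd xs) (hd (tl xs))) (hd xs) (hd (tl xs)))"
  unfolding refutes_def diagram_def var_ok_def meet_ok_def join_ok_def comp_ok_def ldiv_ok_def
    rdiv_ok_def reaches_top_late_def active_def avoids_top_def coded_def
  by (intro computability_intros computable_size_bound computable_code_bound; simp)

section \<open>From refuting tables to valuations\<close>

context
  fixes K :: nat
  assumes K: "0 < K"
begin

lemma point_zero [simp]: "point K 0 = 0"
  using K by (simp add: point_def zero_enat_def)

lemma point_top [simp]: "point K K = \<infinity>"
  by (simp add: point_def)

lemma point_less [simp]: "p < K \<Longrightarrow> point K p = enat p"
  by (simp add: point_def)

lemma point_le_iff: "p \<le> K \<Longrightarrow> q \<le> K \<Longrightarrow> point K p \<le> point K q \<longleftrightarrow> p \<le> q"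
  by (auto simp: point_def)

lemma point_less_iff: "p \<le> K \<Longrightarrow> q \<le> K \<Longrightarrow> point K p < point K q \<longleftrightarrow> p < q"
  by (auto simp: point_def)

lemma point_eq_iff: "p \<le> K \<Longrightarrow> q \<le> K \<Longrightarrow> point K p = point K q \<longleftrightarrow> p = q"
  by (auto simp: point_def)

lemma point_eq_top_iff: "p \<le> K \<Longrightarrow> point K p = \<infinity> \<longleftrightarrow> p = K"
  by (auto simp: point_def)

lemma point_pos_iff: "p \<le> K \<Longrightarrow> 0 < point K p \<longleftrightarrow> 0 < p"
  using point_less_iff[of 0 p] by simp

definition realizes :: "(nat \<Rightarrow> nat \<Rightarrow> nat \<Rightarrow> bool) \<Rightarrow> nat \<Rightarrow> (enat \<Rightarrow> enat) \<Rightarrow> bool" where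
  "realizes R u f \<longleftrightarrow> f \<in> time_warps \<and>
    (\<forall>p\<le>K. \<forall>q\<le>K. R u p q \<longrightarrow> f (point K p) = point K q) \<and>
    (avoids_top R K u \<longrightarrow> finite_valued f)"

lemma realizesD:
  assumes "realizes R u f"
  shows "f \<in> time_warps" "R u p q \<Longrightarrow> p \<le> K \<Longrightarrow> q \<le> K \<Longrightarrow> f (point K p) = point K q"
  using assms by (auto simp: realizes_def)

lemma realizes_finite_valued_iff:
  assumes "realizes R u f"
  shows "finite_valued f \<longleftrightarrow> avoids_top R K u"
proof
  assume fin: "finite_valued f"
  show "avoids_top R K u" unfolding avoids_top_def
  proof (intro allI impI notI)
    fix n
    assume "n < K" "R u n K"
    then have "f (enat n) = \<infinity>" using realizesD(2)[OF assms, of n K] by simp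
    then show False using fin by (metis finite_valued_def)
  qed
qed (use assms in \<open>simp add: realizes_def\<close>)

text \<open>Activity supplies a sample at infinity; without one, the table would not tell whether
  the value there is infinite.\<close>

lemma realizes_unbounded_iff:
  assumes "realizes R u f" "active R K u"
  shows "unbounded f \<longleftrightarrow> reaches_top_late R K u"
proof -
  obtain q where q: "q \<le> K" "R u K q" using assms(2) by (auto simp: active_def)
  then have "f \<infinity> = point K q" using realizesD(2)[OF assms(1), of K q] by simp
  moreover have "f \<infinity> = \<infinity>" if "R u K K" using realizesD(2)[OF assms(1) that] by simp
  ultimately have "f \<infinity> = \<infinity> \<longleftrightarrow> R u K K" using q by (metis point_eq_top_iff)
  then show ?thesis
    by (simp add: unbounded_def reaches_top_late_def realizes_finite_valued_iff[OF assms(1)])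
qed

lemma realizes_meet:
  assumes x: "realizes R x f" and y: "realizes R y g" and ok: "meet_ok R K u x y"
  shows "realizes R u (inf f g)"
  unfolding realizes_def
proof (intro conjI allI impI)
  note fg = realizesD(1)[OF x] realizesD(1)[OF y]
  show "inf f g \<in> time_warps" by (rule time_warps_inf[OF fg])
  show "finite_valued (inf f g)" if "avoids_top R K u"
    using that ok finite_valued_inf[OF fg] realizes_finite_valued_iff[OF x]
      realizes_finite_valued_iff[OF y] unfolding meet_ok_def by blast
  fix p q
  assume "p \<le> K" "q \<le> K" "R u p q"
  then obtain a b where ab: "a \<le> K" "b \<le> K" "R x p a" "R y p b" "a \<le> b \<and> q = a \<or> b \<le> a \<and> q = b"
    using ok unfolding meet_ok_def by blast
  then show "inf f g (point K p) = point K q"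
    using realizesD(2)[OF x, of p a] realizesD(2)[OF y, of p b] \<open>p \<le> K\<close>
    by (auto simp: inf.absorb1 inf.absorb2 point_le_iff)
qed

lemma realizes_join:
  assumes x: "realizes R x f" and y: "realizes R y g" and ok: "join_ok R K u x y"
  shows "realizes R u (sup f g)"
  unfolding realizes_def
proof (intro conjI allI impI)
  note fg = realizesD(1)[OF x] realizesD(1)[OF y]
  show "sup f g \<in> time_warps" by (rule time_warps_sup[OF fg])
  show "finite_valued (sup f g)" if "avoids_top R K u"
    using that ok finite_valued_sup realizes_finite_valued_iff[OF x]
      realizes_finite_valued_iff[OF y] unfolding join_ok_def by blast
  fix p q
  assume "p \<le> K" "q \<le> K" "R u p q"
  then obtain a b where ab: "a \<le> K" "b \<le> K" "R x p a" "R y p b" "a \<le> b \<and> q = b \<or> b \<le> a \<and> q = a"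
    using ok unfolding join_ok_def by blast
  then show "sup f g (point K p) = point K q"
    using realizesD(2)[OF x, of p a] realizesD(2)[OF y, of p b] \<open>p \<le> K\<close>
    by (auto simp: sup.absorb1 sup.absorb2 point_le_iff)
qed

lemma realizes_comp:
  assumes x: "realizes R x f" and y: "realizes R y g" and ok: "comp_ok R K u x y"
  shows "realizes R u (f \<circ> g)"
  unfolding realizes_def
proof (intro conjI)
  note fg = realizesD(1)[OF x] realizesD(1)[OF y]
  show "f \<circ> g \<in> time_warps" by (rule time_warps_comp[OF fg])
  show val: "\<forall>p\<le>K. \<forall>q\<le>K. R u p q \<longrightarrow> (f \<circ> g) (point K p) = point K q"
  proof (intro allI impI)
    fix p q
    assume "p \<le> K" "q \<le> K" "R u p q"
    then obtain a where "a \<le> K" "R y p a" "R x a q" using ok unfolding comp_ok_def by blast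
    then show "(f \<circ> g) (point K p) = point K q"
      using realizesD(2)[OF x, of a q] realizesD(2)[OF y, of p a] \<open>p \<le> K\<close> \<open>q \<le> K\<close> by simp
  qed
  show "avoids_top R K u \<longrightarrow> finite_valued (f \<circ> g)"
  proof
    assume "avoids_top R K u"
    then consider q where "q < K" "R u K q" | "avoids_top R K x" "avoids_top R K y"
      using ok unfolding comp_ok_def by blast
    then have "(f \<circ> g) \<infinity> < \<infinity> \<or> finite_valued f \<and> finite_valued g"
    proof cases
      case 1
      then have "(f \<circ> g) (point K K) = point K q" using val 1 less_imp_le by blast
      then show ?thesis using 1 by simp
    qed (simp add: realizes_finite_valued_iff[OF x] realizes_finite_valued_iff[OF y])
    then show "finite_valued (f \<circ> g)" by (simp only: finite_valued_comp[OF fg])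
  qed
qed

lemma realizes_ldiv:
  assumes x: "realizes R x f" and y: "realizes R y h" and ok: "ldiv_ok R K u x y"
    and act: "active R K y"
  shows "realizes R u (tw_ldiv f h)"
  unfolding realizes_def
proof (intro conjI allI impI)
  note fh = realizesD(1)[OF x] realizesD(1)[OF y]
  show r: "tw_ldiv f h \<in> time_warps" by (rule tw_ldiv_eq(2)[OF fh])
  show "finite_valued (tw_ldiv f h)" if av: "avoids_top R K u"
  proof -
    consider a b where "a \<le> K" "b \<le> K" "R y K a" "R x K b" "a < b"
      | "R x K K" "avoids_top R K y"
      using av ok unfolding ldiv_ok_def by blast
    then have "h \<infinity> < f \<infinity> \<or> f \<infinity> = \<infinity> \<and> finite_valued h"
    proof cases
      case 1
      then have "h \<infinity> = point K a" "f \<infinity> = point K b" "point K a < point K b"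
        using realizesD(2)[OF x, of K b] realizesD(2)[OF y, of K a] point_less_iff[of a b] by simp_all
      then show ?thesis by simp
    next
      case 2
      then show ?thesis
        using realizesD(2)[OF x, of K K] by (simp add: realizes_finite_valued_iff[OF y])
    qed
    then show ?thesis by (simp only: finite_valued_tw_ldiv[OF fh])
  qed
  fix p q
  assume pq: "p \<le> K" "q \<le> K" "R u p q"
  have "p = 0 \<and> q = 0 \<or>
      0 < p \<and> (p < K \<or> \<not> reaches_top_late R K y) \<and>
        (\<exists>a\<le>K. \<exists>b\<le>K. R y p a \<and> R x q b \<and> b \<le> a \<and>
          (q < K \<longrightarrow> Suc q < K \<and> (\<exists>d\<le>K. R x (Suc q) d \<and> a < d))) \<or>
      p = K \<and> reaches_top_late R K y \<and>
        (q = K \<and> avoids_top R K x \<or> Suc q < K \<and> (\<exists>b<K. R x q b) \<and> R x (Suc q) K)"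
    using ok pq unfolding ldiv_ok_def by blast
  then consider "p = 0" "q = 0"
    | a b where "0 < p" "p < K \<or> \<not> reaches_top_late R K y" "a \<le> K" "b \<le> K" "R y p a" "R x q b" "b \<le> a"
        "q < K \<longrightarrow> Suc q < K \<and> (\<exists>d\<le>K. R x (Suc q) d \<and> a < d)"
    | "p = K" "reaches_top_late R K y" "q = K" "avoids_top R K x"
    | b where "p = K" "reaches_top_late R K y" "Suc q < K" "b < K" "R x q b" "R x (Suc q) K"
    by blast
  then show "tw_ldiv f h (point K p) = point K q"
  proof cases
    case 1
    then show ?thesis by (simp add: tw_zero[OF r])
  next
    case 2
    have "0 < point K p" using 2 pq point_pos_iff by blast
    moreover have "point K p \<noteq> \<infinity> \<or> \<not> unbounded h"
      using 2 pq realizes_unbounded_iff[OF y act] by auto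
    moreover have hp: "h (point K p) = point K a" and "f (point K q) = point K b"
      using 2 pq realizesD(2)[OF x, of q b] realizesD(2)[OF y, of p a] by auto
    moreover have "point K a < f (eSuc (point K q))" if "point K q \<noteq> \<infinity>"
    proof -
      have "q < K" using that pq by (metis le_neq_implies_less point_top)
      then obtain d where d: "Suc q < K" "d \<le> K" "R x (Suc q) d" "a < d" using 2 by blast
      then have "f (eSuc (point K q)) = point K d"
        using \<open>q < K\<close> realizesD(2)[OF x, of "Suc q" d] by (simp add: eSuc_enat)
      then show ?thesis using d 2 point_less_iff[of a d] by simp
    qed
    ultimately show ?thesis
      using 2 tw_ldiv_eq_iff[OF fh, of "point K p" "point K q"] by (simp add: point_le_iff)
  next
    case 3
    then show ?thesis
      using tw_ldiv_infinity_eq_iff[OF fh, of \<infinity>] realizes_unbounded_iff[OF y act]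
        realizes_finite_valued_iff[OF x] by simp
  next
    case 4
    then have "f (enat q) = enat b" "f (enat (Suc q)) = \<infinity>"
      using realizesD(2)[OF x, of q b] realizesD(2)[OF x, of "Suc q" K] by auto
    then show ?thesis
      using 4 tw_ldiv_infinity_eq_iff[OF fh, of "enat q"] realizes_unbounded_iff[OF y act]
      by (simp add: eSuc_enat)
  qed
qed

lemma realizes_rdiv:
  assumes x: "realizes R x h" and y: "realizes R y g" and ok: "rdiv_ok R K u x y"
    and act: "active R K y"
  shows "realizes R u (tw_rdiv h g)"
  unfolding realizes_def
proof (intro conjI)
  note hg = realizesD(1)[OF x] realizesD(1)[OF y]
  show r: "tw_rdiv h g \<in> time_warps" by (rule tw_rdiv_eq(2)[OF hg])
  show val: "\<forall>p\<le>K. \<forall>q\<le>K. R u p q \<longrightarrow> tw_rdiv h g (point K p) = point K q"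
  proof (intro allI impI)
    fix p q
    assume pq: "p \<le> K" "q \<le> K" "R u p q"
    have "p = 0 \<and> q = 0 \<or>
      0 < p \<and> (\<exists>a<p. R y K a) \<and> q = K \<or>
      0 < p \<and> (\<exists>n<K. Suc n < K \<and> (\<exists>a\<le>K. R y (Suc n) a \<and> p \<le> a) \<and> (\<exists>b<p. R y n b) \<and>
        R x (Suc n) q) \<or>
      0 < p \<and> p = K \<and> reaches_top_late R K y \<and> R x K q"
      using ok pq unfolding rdiv_ok_def by blast
    then consider "p = 0" "q = 0"
      | a where "0 < p" "a < p" "R y K a" "q = K"
      | n a b where "0 < p" "Suc n < K" "a \<le> K" "R y (Suc n) a" "p \<le> a" "b < p" "R y n b" "R x (Suc n) q"
      | "0 < p" "p = K" "reaches_top_late R K y" "R x K q"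
      by blast
    then show "tw_rdiv h g (point K p) = point K q"
    proof cases
      case 1
      then show ?thesis by (simp add: tw_zero[OF r])
    next
      case 2
      then have "g \<infinity> < point K p"
        using pq realizesD(2)[OF y, of K a] point_less_iff[of a p] by simp
      then show ?thesis
        using 2 pq tw_rdiv_eq_iff[OF hg, of "point K p" \<infinity>] point_pos_iff[of p] by simp
    next
      case 3
      then have "point K p \<le> g (enat (Suc n))" "g (enat n) < point K p" "point K q = h (enat (Suc n))"
        using pq realizesD(2)[OF y, of "Suc n" a] realizesD(2)[OF y, of n b]
          realizesD(2)[OF x, of "Suc n" q] point_less_iff[of b p] by (simp_all add: point_le_iff)
      then show ?thesis
        using 3 pq tw_rdiv_eq_iff[OF hg, of "point K p" "point K q"] point_pos_iff[of p] by blast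
    next
      case 4
      then have "point K q = h \<infinity>" "unbounded g"
        using pq realizesD(2)[OF x, of K q] realizes_unbounded_iff[OF y act] by auto
      then show ?thesis
        using 4 tw_rdiv_eq_iff[OF hg, of "point K p" "point K q"] by simp
    qed
  qed
  show "avoids_top R K u \<longrightarrow> finite_valued (tw_rdiv h g)"
  proof
    assume "avoids_top R K u"
    then consider q where "q < K" "R u K q" | "reaches_top_late R K y" "avoids_top R K x"
      using ok unfolding rdiv_ok_def by blast
    then have "tw_rdiv h g \<infinity> < \<infinity> \<or> unbounded g \<and> finite_valued h"
    proof cases
      case 1
      then have "tw_rdiv h g (point K K) = point K q" using val 1 less_imp_le by blast
      then show ?thesis using 1 by simp
    qed (simp add: realizes_finite_valued_iff[OF x] realizes_unbounded_iff[OF y act])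
    then show "finite_valued (tw_rdiv h g)" by (simp only: finite_valued_tw_rdiv[OF hg])
  qed
qed

text \<open>The least monotone extension of the table, except that a warp which is to be unbounded
  is continued by the identity beyond K.\<close>

definition realizing_warp :: "(nat \<Rightarrow> nat \<Rightarrow> nat \<Rightarrow> bool) \<Rightarrow> nat \<Rightarrow> enat \<Rightarrow> enat" where
  "realizing_warp R u x =
    sup (Sup {point K q |p q. p \<le> K \<and> q \<le> K \<and> R u p q \<and> point K p \<le> x})
      (if reaches_top_late R K u \<and> enat K \<le> x then x else 0)"

lemma realizing_warp_point:
  assumes ok: "var_ok R K u" and pq: "p \<le> K" "q \<le> K" "R u p q"
  shows "realizing_warp R u (point K p) = point K q"
proof -
  have mono: "q' \<le> q" if "p' \<le> p" "p' \<le> K" "q' \<le> K" "R u p' q'" for p' q'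
    using ok pq that unfolding var_ok_def by blast
  have "Sup {point K q |p' q. p' \<le> K \<and> q \<le> K \<and> R u p' q \<and> point K p' \<le> point K p} = point K q"
    by (rule antisym[OF Sup_least Sup_upper]) (use pq mono in \<open>auto simp: point_le_iff\<close>)
  \<comment> \<open>The continuation by the identity touches the table only at infinity, where the
    sample K at K and monotonicity give the value K.\<close>
  moreover have "q = K" if "reaches_top_late R K u" "enat K \<le> point K p"
  proof -
    have "p = K" using that(2) pq by (auto simp: point_def split: if_splits)
    then show ?thesis using that(1) pq mono[of K K] by (simp add: reaches_top_late_def)
  qed
  ultimately show ?thesis by (auto simp: realizing_warp_def sup.absorb1)
qed

lemma realizing_warp_time_warp:
  assumes ok: "var_ok R K u"
  shows "realizing_warp R u \<in> time_warps"
proof (rule time_warpsI)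
  show "mono (realizing_warp R u)"
  proof (rule monoI)
    fix x y :: enat
    assume "x \<le> y"
    have "Sup {point K q |p q. p \<le> K \<and> q \<le> K \<and> R u p q \<and> point K p \<le> x}
        \<le> Sup {point K q |p q. p \<le> K \<and> q \<le> K \<and> R u p q \<and> point K p \<le> y}"
      by (rule Sup_subset_mono) (use order_trans[OF _ \<open>x \<le> y\<close>] in blast)
    moreover have "(if reaches_top_late R K u \<and> enat K \<le> x then x else 0)
        \<le> (if reaches_top_late R K u \<and> enat K \<le> y then y else 0)"
      using \<open>x \<le> y\<close> order_trans[of "enat K" x y] by simp
    ultimately show "realizing_warp R u x \<le> realizing_warp R u y"
      unfolding realizing_warp_def by (rule sup_mono)
  qed
  have "point K q = 0" if "p \<le> K" "q \<le> K" "R u p q" "point K p \<le> 0" for p q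
  proof -
    have "p = 0" using that point_le_iff[of p 0] by simp
    then have "q = 0" using ok that(1-3) unfolding var_ok_def by blast
    then show ?thesis by simp
  qed
  then have "{point K q |p q. p \<le> K \<and> q \<le> K \<and> R u p q \<and> point K p \<le> 0} \<subseteq> {0}" by blast
  then have "Sup {point K q |p q. p \<le> K \<and> q \<le> K \<and> R u p q \<and> point K p \<le> 0} \<le> Sup {0}"
    by (rule Sup_subset_mono)
  then show "realizing_warp R u 0 = 0" by (simp add: realizing_warp_def)
  let ?S = "SUP n. realizing_warp R u (enat n)"
  have up: "realizing_warp R u (enat n) \<le> ?S" for n by (rule SUP_upper) simp
  have late: "?S = \<infinity>" if "reaches_top_late R K u"
  proof -
    have "enat n \<le> ?S" for n
    proof -
      have "enat n \<le> realizing_warp R u (enat (n + K))"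
        using that by (simp add: realizing_warp_def le_supI2)
      then show ?thesis using up by (rule order_trans)
    qed
    then show ?thesis by (metis enat_ord_simps(1) linorder_not_less enat.exhaust lessI)
  qed
  \<comment> \<open>Continuity: a value sampled at infinity is also sampled at a finite point, or it
    is infinity and the identity part climbs to it.\<close>
  have "point K q \<le> ?S" if pq: "p \<le> K" "q \<le> K" "R u p q" for p q
  proof (cases "p < K")
    case True
    then show ?thesis using realizing_warp_point[OF ok pq] up[of p] by simp
  next
    case False
    then have "p = K" using pq by simp
    then have "q = K \<and> avoids_top R K u \<or> (\<exists>n<K. R u n q)"
      using ok pq unfolding var_ok_def by blast
    then show ?thesis
    proof
      assume "q = K \<and> avoids_top R K u"
      then show ?thesis using late pq \<open>p = K\<close> by (simp add: reaches_top_late_def)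
    next
      assume "\<exists>n<K. R u n q"
      then obtain n where "n < K" "R u n q" by blast
      then show ?thesis using realizing_warp_point[OF ok, of n q] up[of n] pq by simp
    qed
  qed
  then show "realizing_warp R u \<infinity> \<le> ?S"
    unfolding realizing_warp_def[of R u \<infinity>] using late by (auto intro!: Sup_least)
qed

lemma realizes_realizing_warp:
  assumes ok: "var_ok R K u"
  shows "realizes R u (realizing_warp R u)"
  unfolding realizes_def
proof (intro conjI allI impI)
  show "finite_valued (realizing_warp R u)" if av: "avoids_top R K u"
    unfolding finite_valued_def
  proof
    fix n
    \<comment> \<open>Only samples at points below K count here, and none of them has the value K;
      the identity part adds at most n.\<close>
    have "Sup {point K q |p q. p \<le> K \<and> q \<le> K \<and> R u p q \<and> point K p \<le> enat n} \<le> enat K"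
    proof (rule Sup_least, clarify)
      fix p q
      assume pq: "p \<le> K" "q \<le> K" "R u p q" "point K p \<le> enat n"
      then have "p < K" by (auto simp: point_def split: if_splits)
      then have "q \<noteq> K" using av pq by (auto simp: avoids_top_def)
      then show "point K q \<le> enat K" using pq by simp
    qed
    then have "realizing_warp R u (enat n) \<le> sup (enat K) (enat n)"
      unfolding realizing_warp_def by (intro sup_mono) auto
    then show "realizing_warp R u (enat n) \<noteq> \<infinity>"
      by (metis enat_ord_simps(5) sup_enat_def max_def enat.distinct(1))
  qed
qed (use ok realizing_warp_time_warp realizing_warp_point in auto)

text \<open>A diagram checks only variables with small index; the default makes the result a time
  warp for every index.\<close>

definition realizing_valuation :: "(nat \<Rightarrow> nat \<Rightarrow> nat \<Rightarrow> bool) \<Rightarrow> nat \<Rightarrow> enat \<Rightarrow> enat" where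
  "realizing_valuation R i =
    (if var_ok R K (prod_encode (0, i)) then realizing_warp R (prod_encode (0, i)) else tw_bot)"

lemma realizes_tw_eval:
  assumes D: "diagram R K c"
  shows "encode_term u \<le> c \<Longrightarrow> active R K (encode_term u) \<Longrightarrow>
    realizes R (encode_term u) (tw_eval (realizing_valuation R) u)"
proof -
  have bin: "encode_term x \<le> c \<and> encode_term y \<le> c \<and> active R K (encode_term x) \<and> active R K (encode_term y) \<and>
      (k = 1 \<longrightarrow> meet_ok R K (prod_encode (k, prod_encode (encode_term x, encode_term y))) (encode_term x) (encode_term y)) \<and>
      (k = 2 \<longrightarrow> join_ok R K (prod_encode (k, prod_encode (encode_term x, encode_term y))) (encode_term x) (encode_term y)) \<and>
      (k = 3 \<longrightarrow> comp_ok R K (prod_encode (k, prod_encode (encode_term x, encode_term y))) (encode_term x) (encode_term y)) \<and>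
      (k = 4 \<longrightarrow> ldiv_ok R K (prod_encode (k, prod_encode (encode_term x, encode_term y))) (encode_term x) (encode_term y)) \<and>
      (k = 5 \<longrightarrow> rdiv_ok R K (prod_encode (k, prod_encode (encode_term x, encode_term y))) (encode_term x) (encode_term y))"
    if "prod_encode (k, prod_encode (encode_term x, encode_term y)) \<le> c" "0 < k" "k \<le> 5"
      "active R K (prod_encode (k, prod_encode (encode_term x, encode_term y)))" for k x y
  proof -
    have "encode_term x \<le> c" "encode_term y \<le> c"
      using that(1) le_prod_encode_1 le_prod_encode_2 by (meson order_trans)+
    then show ?thesis using D that(2-4) unfolding diagram_def by blast
  qed
  show "encode_term u \<le> c \<Longrightarrow> active R K (encode_term u) \<Longrightarrow>
    realizes R (encode_term u) (tw_eval (realizing_valuation R) u)"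
  proof (induction u)
    case (TVar i)
    have "i \<le> c" using TVar(1) le_prod_encode_2[of i 0] by simp
    then have "var_ok R K (prod_encode (0, i))" using D unfolding diagram_def by blast
    then show ?case by (simp add: realizing_valuation_def realizes_realizing_warp)
  next
    case (TMeet x y)
    show ?case unfolding tw_eval.simps encode_term.simps
      by (rule realizes_meet[of R "encode_term x" _ "encode_term y"]) (use TMeet bin[of 1 x y] in auto)
  next
    case (TJoin x y)
    show ?case unfolding tw_eval.simps encode_term.simps
      by (rule realizes_join[of R "encode_term x" _ "encode_term y"]) (use TJoin bin[of 2 x y] in auto)
  next
    case (TComp x y)
    show ?case unfolding tw_eval.simps encode_term.simps
      by (rule realizes_comp[of R "encode_term x" _ "encode_term y"]) (use TComp bin[of 3 x y] in auto)
  next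
    case (TLdiv x y)
    show ?case unfolding tw_eval.simps encode_term.simps
      by (rule realizes_ldiv[of R "encode_term x" _ "encode_term y"]) (use TLdiv bin[of 4 x y] in auto)
  next
    case (TRdiv x y)
    show ?case unfolding tw_eval.simps encode_term.simps
      by (rule realizes_rdiv[of R "encode_term x" _ "encode_term y"]) (use TRdiv bin[of 5 x y] in auto)
  next
    case TId
    have "\<forall>p\<le>K. \<forall>q\<le>K. R (prod_encode (6, 0)) p q \<longrightarrow> q = p" using D unfolding diagram_def by blast
    then show ?case
      unfolding tw_eval.simps encode_term.simps realizes_def
      by (intro conjI time_warps_id) (auto simp: finite_valued_def)
  next
    case TBot
    have "\<forall>p\<le>K. \<forall>q\<le>K. R (prod_encode (7, 0)) p q \<longrightarrow> q = 0" using D unfolding diagram_def by blast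
    then show ?case
      unfolding tw_eval.simps encode_term.simps realizes_def
      by (intro conjI time_warps_bot) (metis point_zero tw_bot_def, simp add: finite_valued_def tw_bot_def)
  next
    case TTop
    have top: "\<forall>p\<le>K. \<forall>q\<le>K. R (prod_encode (8, 0)) p q \<longrightarrow>
      (p = 0 \<and> q = 0 \<or> 0 < p \<and> q = K) \<and> \<not> avoids_top R K (prod_encode (8, 0))"
      using D unfolding diagram_def by blast
    \<comment> \<open>Activity provides a sample of the top warp, which triggers the clause.\<close>
    moreover have "\<not> avoids_top R K (prod_encode (8, 0))"
      using top TTop(2) unfolding active_def by auto
    moreover have "tw_top (point K p) = point K q" if pq: "p \<le> K" "q \<le> K" "R (prod_encode (8, 0)) p q" for p q
    proof -
      have "p = 0 \<and> q = 0 \<or> 0 < p \<and> q = K" using top pq by blast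
      then show ?thesis using point_pos_iff[OF pq(1)] by (auto simp: tw_top_def)
    qed
    ultimately show ?case by (simp add: realizes_def time_warps_top)
  qed
qed

lemma refutes_sound:
  assumes "refutes R K (encode_term s) (encode_term t)"
  shows "\<not> W_models s t"
proof -
  let ?v = "realizing_valuation R"
  have D: "diagram R K (encode_term s + encode_term t)"
    and act: "active R K (encode_term s)" "active R K (encode_term t)"
    using assms by (auto simp: refutes_def)
  obtain p a b where pab: "p \<le> K" "a \<le> K" "b \<le> K" "R (encode_term s) p a" "R (encode_term t) p b" "a \<noteq> b"
    using assms unfolding refutes_def by blast
  have "tw_eval ?v s (point K p) = point K a"
    using realizesD(2)[OF realizes_tw_eval[OF D _ act(1)]] pab by simp
  moreover have "tw_eval ?v t (point K p) = point K b"
    using realizesD(2)[OF realizes_tw_eval[OF D _ act(2)]] pab by simp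
  ultimately have "tw_eval ?v s \<noteq> tw_eval ?v t" using pab point_eq_iff by metis
  moreover have "\<forall>i. ?v i \<in> time_warps"
    by (simp add: realizing_valuation_def realizing_warp_time_warp time_warps_bot)
  ultimately show ?thesis unfolding W_models_def by blast
qed

end

section \<open>Finite sets of samples\<close>

lemma encode_term_inject: "encode_term u = encode_term w \<longleftrightarrow> u = w"
proof
  show "encode_term u = encode_term w \<Longrightarrow> u = w"
  proof (induction u arbitrary: w)
    case (TVar i)
    then show ?case by (cases w) auto
  next
    case (TMeet x y)
    then show ?case by (cases w) auto
  next
    case (TJoin x y)
    then show ?case by (cases w) auto
  next
    case (TComp x y)
    then show ?case by (cases w) auto
  next
    case (TLdiv x y)
    then show ?case by (cases w) auto
  next
    case (TRdiv x y)
    then show ?case by (cases w) auto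
  next
    case TId
    then show ?case by (cases w) auto
  next
    case TBot
    then show ?case by (cases w) auto
  next
    case TTop
    then show ?case by (cases w) auto
  qed
qed simp

section \<open>Growth of term codes and size of closed sample sets\<close>

lemma triangle_mono: "a \<le> b \<Longrightarrow> triangle a \<le> triangle b"
  by (induction b) (auto simp: le_Suc_eq)

lemma prod_encode_mono: "a \<le> a' \<Longrightarrow> b \<le> b' \<Longrightarrow> prod_encode (a, b) \<le> prod_encode (a', b')"
  using triangle_mono[of "a + b" "a' + b'"] by (simp add: prod_encode_def)

lemma add_le_prod_encode: "a + b \<le> prod_encode (a, b)"
proof -
  have "n \<le> triangle n" for n by (induction n) auto
  then show ?thesis by (simp add: prod_encode_def trans_le_add1)
qed

text \<open>The least point where the value at infinity is attained; it is infinite only for unbounded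
  warps.\<close>

definition witness :: "(nat \<Rightarrow> enat \<Rightarrow> enat) \<Rightarrow> tw_term \<Rightarrow> enat" where
  "witness v u = (LEAST p. tw_eval v u p = tw_eval v u \<infinity>)"

text \<open>The values of the immediate subterms that determine the value at p. The right residual h/g at p
  is h at the least m with p below g m, and g at m - 1 certifies minimality; if no such m exists,
  the LEAST is unspecified, which is harmless.\<close>

fun needs :: "(nat \<Rightarrow> enat \<Rightarrow> enat) \<Rightarrow> tw_term \<Rightarrow> enat \<Rightarrow> (tw_term \<times> enat) set" where
  "needs v (TMeet x y) p = {(x, p), (y, p)}"
| "needs v (TJoin x y) p = {(x, p), (y, p)}"
| "needs v (TComp x y) p = {(y, p), (x, tw_eval v y p)}"
| "needs v (TLdiv x y) p =
    {(y, p), (x, tw_eval v (TLdiv x y) p), (x, eSuc (tw_eval v (TLdiv x y) p))}"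
| "needs v (TRdiv x y) p =
    (let m = LEAST m. p \<le> tw_eval v y m in {(y, m), (y, m - 1), (x, m)})"
| "needs v _ p = {}"

text \<open>Infinity and the witness are added for every sampled term, so that activity and
  \<open>avoids_top\<close> of the resulting table describe the actual warp.\<close>

definition closed_samples :: "(nat \<Rightarrow> enat \<Rightarrow> enat) \<Rightarrow> (tw_term \<times> enat) set \<Rightarrow> bool" where
  "closed_samples v S \<longleftrightarrow> (\<forall>(u, p)\<in>S. {(u, \<infinity>), (u, witness v u)} \<union> needs v u p \<subseteq> S)"

text \<open>Adding 3 to the number of points makes the recurrence homogeneous: a node adds 2 points
  and asks for at most 3 values per point, and 3 * (n + 2) + 3 = 3 * (n + 3).\<close>

definition small_samples :: "(nat \<Rightarrow> enat \<Rightarrow> enat) \<Rightarrow> tw_term \<Rightarrow> enat set \<Rightarrow> (tw_term \<times> enat) set \<Rightarrow> bool" where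
  "small_samples v u P S \<longleftrightarrow> finite S \<and> closed_samples v S \<and> {u} \<times> P \<subseteq> S \<and>
    (\<forall>(w, p)\<in>S. encode_term w \<le> encode_term u) \<and>
    card S \<le> (card P + 3) * 8 ^ encode_term u"

lemma finite_needs: "finite (needs v u p)"
  by (cases u) (auto simp: Let_def)

lemma card_needs: "card (needs v u p) \<le> 3"
proof -
  have "card {a, b} \<le> 3" "card {a, b, c} \<le> 3" for a b c :: "tw_term \<times> enat"
    using card_insert_le_m1[of 3 "{b, c}" a] card_insert_le_m1[of 2 "{c}" b]
      card_insert_le_m1[of 2 "{b}" a] by auto
  then show ?thesis by (cases u) (simp_all add: Let_def)
qed

lemma closed_samples_Un: "closed_samples v S \<Longrightarrow> closed_samples v T \<Longrightarrow> closed_samples v (S \<union> T)"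
  unfolding closed_samples_def by blast

lemma small_samples_leaf:
  assumes P: "finite P" and leaf: "\<And>p. needs v u p = {}"
  shows "\<exists>S. small_samples v u P S"
proof
  let ?S = "{u} \<times> (P \<union> {\<infinity>, witness v u})"
  have "card ?S \<le> card P + card {\<infinity>, witness v u}"
    by (simp only: card_cartesian_product_singleton) (rule card_Un_le)
  also have "\<dots> \<le> card P + 3" using card_insert_le_m1[of 2 "{witness v u}" \<infinity>] by simp
  also have "\<dots> \<le> (card P + 3) * 8 ^ encode_term u" by simp
  finally show "small_samples v u P ?S"
    using P leaf by (auto simp: small_samples_def closed_samples_def)
qed

lemma small_samples_node:
  assumes P: "finite P" and children: "\<And>p. fst ` needs v u p \<subseteq> {x, y}"
    and less: "encode_term x + encode_term y < encode_term u"
    and x: "\<And>P. finite P \<Longrightarrow> \<exists>S. small_samples v x P S"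
    and y: "\<And>P. finite P \<Longrightarrow> \<exists>S. small_samples v y P S"
  shows "\<exists>S. small_samples v u P S"
proof -
  define P' where "P' = P \<union> {\<infinity>, witness v u}"
  \<comment> \<open>Both arguments are sampled at all requested points, no matter for which of them
    a point was requested.\<close>
  define Q where "Q = snd ` (\<Union>p\<in>P'. needs v u p)"
  have "finite P'" using P by (simp add: P'_def)
  then have "finite Q" by (simp add: Q_def finite_needs)
  have "card P' \<le> card P + card {\<infinity>, witness v u}" unfolding P'_def by (rule card_Un_le)
  also have "\<dots> \<le> card P + 2" using card_insert_le_m1[of 2 "{witness v u}" \<infinity>] by simp
  finally have cP': "card P' \<le> card P + 2" .
  have "card Q \<le> card (\<Union>p\<in>P'. needs v u p)"
    unfolding Q_def by (rule card_image_le) (simp add: \<open>finite P'\<close> finite_needs)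
  also have "\<dots> \<le> (\<Sum>p\<in>P'. card (needs v u p))" by (rule card_UN_le[OF \<open>finite P'\<close>])
  also have "\<dots> \<le> (\<Sum>p\<in>P'. 3)" by (rule sum_mono) (rule card_needs)
  also have "\<dots> = 3 * card P'" by simp
  finally have cQ: "card Q + 3 \<le> 3 * (card P + 3)" using cP' by simp
  obtain A where A: "small_samples v x Q A" using x[OF \<open>finite Q\<close>] ..
  obtain B where B: "small_samples v y Q B" using y[OF \<open>finite Q\<close>] ..
  let ?S = "{u} \<times> P' \<union> (A \<union> B)"
  have "closed_samples v ?S"
  proof -
    have "needs v u p \<subseteq> {x, y} \<times> Q" if "p \<in> P'" for p
      using children[of p] that unfolding Q_def by force
    moreover have "{x, y} \<times> Q \<subseteq> A \<union> B" using A B by (auto simp: small_samples_def)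
    ultimately have "needs v u p \<subseteq> A \<union> B" if "p \<in> P'" for p using that by blast
    moreover have "closed_samples v (A \<union> B)"
      using A B closed_samples_Un by (simp add: small_samples_def)
    moreover have "{\<infinity>, witness v u} \<subseteq> P'" by (simp add: P'_def)
    ultimately show ?thesis unfolding closed_samples_def by blast
  qed
  moreover have "card ?S \<le> (card P + 3) * 8 ^ encode_term u"
  proof -
    let ?n = "card P + 3" and ?x = "(8::nat) ^ encode_term x" and ?y = "(8::nat) ^ encode_term y"
    have "card ?S \<le> card ({u} \<times> P') + (card A + card B)"
      using card_Un_le[of "{u} \<times> P'" "A \<union> B"] card_Un_le[of A B] by linarith
    also have "\<dots> \<le> ?n + (3 * ?n * ?x + 3 * ?n * ?y)"
    proof (intro add_mono)
      show "card ({u} \<times> P') \<le> ?n" using cP' by (simp add: card_cartesian_product_singleton)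
      have "card A \<le> (card Q + 3) * ?x" "card B \<le> (card Q + 3) * ?y"
        using A B by (auto simp: small_samples_def)
      then show "card A \<le> 3 * ?n * ?x" "card B \<le> 3 * ?n * ?y"
        using mult_le_mono1[OF cQ, of ?x] mult_le_mono1[OF cQ, of ?y] by (auto intro: order_trans)
    qed
    also have "\<dots> = ?n * (1 + 3 * ?x + 3 * ?y)" by (simp add: algebra_simps)
    \<comment> \<open>The origin of the base 8: the sum is at most seven times the product, and the
      strict growth of codes pays for one additional factor 8.\<close>
    also have "\<dots> \<le> ?n * (8 * (?x * ?y))"
    proof (rule mult_le_mono2)
      have "?x \<le> ?x * ?y" "?y \<le> ?x * ?y" "1 \<le> ?x * ?y" by simp_all
      then show "1 + 3 * ?x + 3 * ?y \<le> 8 * (?x * ?y)" by linarith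
    qed
    also have "8 * (?x * ?y) = 8 ^ Suc (encode_term x + encode_term y)" by (simp add: power_add)
    also have "?n * 8 ^ Suc (encode_term x + encode_term y) \<le> ?n * 8 ^ encode_term u"
      using less by (intro mult_le_mono2 power_increasing) auto
    finally show ?thesis .
  qed
  moreover have "\<forall>(w, p)\<in>?S. encode_term w \<le> encode_term u"
    using A B less by (fastforce simp: small_samples_def)
  moreover have "finite ?S" using A B \<open>finite P'\<close> by (simp add: small_samples_def)
  moreover have "{u} \<times> P \<subseteq> ?S" by (auto simp: P'_def)
  ultimately have "small_samples v u P ?S" unfolding small_samples_def by (intro conjI)
  then show ?thesis ..
qed

text \<open>The positive tag accounts for the strict inequality.\<close>

lemma encode_child_less:
  "0 < k \<Longrightarrow> encode_term x + encode_term y < prod_encode (k, prod_encode (encode_term x, encode_term y))"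
  using add_le_prod_encode[of k "prod_encode (encode_term x, encode_term y)"]
    add_le_prod_encode[of "encode_term x" "encode_term y"] by linarith

lemma small_samples_exist: "finite P \<Longrightarrow> \<exists>S. small_samples v u P S"
proof (induction u arbitrary: P)
  case (TMeet x y)
  show ?case
    by (rule small_samples_node[of _ _ _ x y]) (use TMeet encode_child_less in auto)
next
  case (TJoin x y)
  show ?case
    by (rule small_samples_node[of _ _ _ x y]) (use TJoin encode_child_less in auto)
next
  case (TComp x y)
  show ?case
    by (rule small_samples_node[of _ _ _ x y]) (use TComp encode_child_less in auto)
next
  case (TLdiv x y)
  show ?case
    by (rule small_samples_node[of _ _ _ x y]) (use TLdiv encode_child_less in auto)
next
  case (TRdiv x y)
  show ?case
    by (rule small_samples_node[of _ _ _ x y]) (use TRdiv encode_child_less in \<open>auto simp: Let_def\<close>)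
qed (rule small_samples_leaf; simp)+

section \<open>From refuting valuations to tables\<close>

locale samples =
  fixes v :: "nat \<Rightarrow> enat \<Rightarrow> enat" and S :: "(tw_term \<times> enat) set" and K :: nat
  assumes v: "\<And>i. v i \<in> time_warps" and finite_S: "finite S" and closed: "closed_samples v S"
    and K: "2 * card S + 2 < K"
begin

definition levels :: "enat set" where
  "levels = {0, \<infinity>} \<union> (snd ` S \<union> (\<lambda>(u, p). tw_eval v u p) ` S)"

text \<open>Infinity is sent to K and not to its count, since K stands for infinity in tables;
  finite ranks stay below K because there are fewer than K levels.\<close>

definition rank :: "enat \<Rightarrow> nat" where
  "rank x = (if x = \<infinity> then K else card {y \<in> levels. y < x})"

definition sampled :: "nat \<Rightarrow> nat \<Rightarrow> nat \<Rightarrow> bool" where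
  "sampled c p q \<longleftrightarrow> (\<exists>(u, a)\<in>S. c = encode_term u \<and> p = rank a \<and> q = rank (tw_eval v u a))"

lemma tw: "tw_eval v u \<in> time_warps"
  by (rule tw_eval_time_warp) (rule v)

lemma finite_levels: "finite levels"
  unfolding levels_def using finite_S by simp

lemma card_levels: "card levels < K"
proof -
  have "card levels \<le> card {0::enat, \<infinity>} + (card (snd ` S) + card ((\<lambda>(u, p). tw_eval v u p) ` S))"
    unfolding levels_def by (meson card_Un_le add_mono order_refl order_trans)
  also have "\<dots> \<le> 2 + (card S + card S)"
    using finite_S by (intro add_mono card_image_le) auto
  finally show ?thesis using K by simp
qed

lemma levels_sample: "(u, p) \<in> S \<Longrightarrow> p \<in> levels" "(u, p) \<in> S \<Longrightarrow> tw_eval v u p \<in> levels"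
  unfolding levels_def by force+

lemma levels_const: "0 \<in> levels" "\<infinity> \<in> levels"
  by (auto simp: levels_def)

lemma rank_top [simp]: "rank \<infinity> = K"
  by (simp add: rank_def)

lemma rank_zero [simp]: "rank 0 = 0"
  by (simp add: rank_def)

lemma rank_finite: "x \<noteq> \<infinity> \<Longrightarrow> rank x < K"
  using card_levels card_mono[OF finite_levels, of "{y \<in> levels. y < x}"]
  by (simp add: rank_def)

lemma rank_le: "rank x \<le> K"
  using rank_finite[of x] by (cases "x = \<infinity>") auto

lemma rank_less_top_iff: "rank x < K \<longleftrightarrow> x \<noteq> \<infinity>"
  using rank_finite rank_top by (metis less_irrefl)

lemma rank_eq_top_iff: "rank x = K \<longleftrightarrow> x = \<infinity>"
  using rank_finite rank_top by (metis less_irrefl)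

lemma rank_less_iff:
  assumes "x \<in> levels" "y \<in> levels"
  shows "rank x < rank y \<longleftrightarrow> x < y"
proof -
  have mono: "rank x < rank y" if "x < y" "x \<in> levels" for x y
  proof (cases "y = \<infinity>")
    case True
    then show ?thesis using that rank_finite[of x] by auto
  next
    case False
    have "x \<noteq> \<infinity>" using \<open>x < y\<close> by (metis enat_ord_simps(6))
    have "{z \<in> levels. z < x} \<subset> {z \<in> levels. z < y}" using that by auto
    then have "card {z \<in> levels. z < x} < card {z \<in> levels. z < y}"
      using finite_levels by (intro psubset_card_mono) auto
    then show ?thesis using False \<open>x \<noteq> \<infinity>\<close> by (simp add: rank_def del: not_infinity_eq)
  qed
  show ?thesis using mono[of x y] mono[of y x] assms by (cases x y rule: linorder_cases) auto
qed

lemma rank_le_iff: "x \<in> levels \<Longrightarrow> y \<in> levels \<Longrightarrow> rank x \<le> rank y \<longleftrightarrow> x \<le> y"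
  using rank_less_iff[of y x] by (simp flip: not_less)

lemma rank_eq_iff: "x \<in> levels \<Longrightarrow> y \<in> levels \<Longrightarrow> rank x = rank y \<longleftrightarrow> x = y"
  using rank_le_iff by (simp add: eq_iff)

lemma rank_pos: "x \<in> levels \<Longrightarrow> x \<noteq> 0 \<Longrightarrow> 0 < rank x"
  using rank_less_iff[OF levels_const(1), of x] by simp

text \<open>No number lies strictly between x and its successor, so the count grows by exactly the
  level x. The successor need not be a level.\<close>

lemma rank_eSuc:
  assumes "x \<in> levels" "x \<noteq> \<infinity>"
  shows "rank (eSuc x) = Suc (rank x)"
proof -
  have "{y \<in> levels. y < eSuc x} = insert x {y \<in> levels. y < x}"
  proof -
    have "y < eSuc x \<longleftrightarrow> y = x \<or> y < x" for y
      using assms(2) by (cases x; cases y) (auto simp: eSuc_enat less_Suc_eq)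
    then show ?thesis using assms(1) by blast
  qed
  moreover have "eSuc x \<noteq> \<infinity>" using assms by (metis eSuc_infinity eSuc_inject)
  ultimately show ?thesis using assms finite_levels by (simp add: rank_def del: not_infinity_eq)
qed

lemma sampledI: "(u, a) \<in> S \<Longrightarrow> sampled (encode_term u) (rank a) (rank (tw_eval v u a))"
  unfolding sampled_def by force

lemma sampled_topI: "(u, \<infinity>) \<in> S \<Longrightarrow> sampled (encode_term u) K (rank (tw_eval v u \<infinity>))"
  using sampledI[of u \<infinity>] by simp

lemma sampledE:
  assumes "sampled (encode_term u) p q"
  obtains a where "(u, a) \<in> S" "p = rank a" "q = rank (tw_eval v u a)" "a \<in> levels"
    "tw_eval v u a \<in> levels"
  using assms levels_sample unfolding sampled_def by (auto simp: encode_term_inject)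

lemma sampled_topD:
  assumes "sampled (encode_term u) K q"
  shows "q = rank (tw_eval v u \<infinity>)"
proof -
  obtain a where "K = rank a" "q = rank (tw_eval v u a)" using assms by (rule sampledE)
  then show ?thesis using rank_eq_top_iff by metis
qed

lemma sample_closed: "(u, p) \<in> S \<Longrightarrow> (u, \<infinity>) \<in> S" "(u, p) \<in> S \<Longrightarrow> (u, witness v u) \<in> S"
  "(u, p) \<in> S \<Longrightarrow> needs v u p \<subseteq> S"
  using closed unfolding closed_samples_def by blast+

lemma witness_eval: "tw_eval v u (witness v u) = tw_eval v u \<infinity>"
  unfolding witness_def by (rule LeastI[of _ \<infinity>]) simp

lemma witness_finite:
  assumes "\<not> unbounded (tw_eval v u)"
  shows "witness v u \<noteq> \<infinity>"
proof -
  obtain N where "tw_eval v u (enat N) = tw_eval v u \<infinity>" using tw_attained[OF tw assms] by blast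
  then have "witness v u \<le> enat N" unfolding witness_def by (rule Least_le)
  then show ?thesis by (metis enat_ord_simps(5) enat.distinct(1))
qed

text \<open>Here the witness matters: a warp that is infinite at some finite point has a finite
  witness with value infinity, and closure puts it among the samples.\<close>

lemma avoids_top_iff:
  assumes "(u, p) \<in> S"
  shows "avoids_top sampled K (encode_term u) \<longleftrightarrow> finite_valued (tw_eval v u)"
proof
  assume fin: "finite_valued (tw_eval v u)"
  show "avoids_top sampled K (encode_term u)" unfolding avoids_top_def
  proof (intro allI impI notI)
    fix n
    assume "n < K" "sampled (encode_term u) n K"
    then obtain a where "a \<noteq> \<infinity>" "tw_eval v u a = \<infinity>"
      by (elim sampledE) (metis rank_eq_top_iff rank_less_top_iff)
    then show False using finite_valuedD[OF fin, of a] by simp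
  qed
next
  assume av: "avoids_top sampled K (encode_term u)"
  show "finite_valued (tw_eval v u)"
  proof (rule ccontr)
    assume fin: "\<not> finite_valued (tw_eval v u)"
    then have "tw_eval v u \<infinity> = \<infinity>"
      using finite_valued_bounded[OF tw, of u] by (metis enat_ord_simps(4))
    then have "sampled (encode_term u) (rank (witness v u)) K"
      using sampledI[OF sample_closed(2)[OF assms]] witness_eval[of u] by simp
    moreover have "rank (witness v u) < K"
      using fin witness_finite[of u] by (intro rank_finite) (simp add: unbounded_def)
    ultimately show False using av by (simp add: avoids_top_def)
  qed
qed

lemma reaches_top_late_iff:
  assumes "(u, p) \<in> S"
  shows "reaches_top_late sampled K (encode_term u) \<longleftrightarrow> unbounded (tw_eval v u)"
proof -
  have "sampled (encode_term u) K K \<longleftrightarrow> tw_eval v u \<infinity> = \<infinity>"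
    using sampled_topI[OF sample_closed(1)[OF assms]] sampled_topD[of u K] rank_eq_top_iff by metis
  then show ?thesis by (simp add: reaches_top_late_def unbounded_def avoids_top_iff[OF assms])
qed

lemma active_sampled: "(u, p) \<in> S \<Longrightarrow> active sampled K (encode_term u)"
  unfolding active_def using sampled_topI[OF sample_closed(1)] rank_le by blast

lemma active_sampledE:
  assumes "active sampled K c"
  obtains u p where "(u, p) \<in> S" "c = encode_term u"
  using assms unfolding active_def sampled_def by auto

lemma var_ok: "var_ok sampled K (encode_term (TVar i))"
  unfolding var_ok_def
proof (intro allI impI conjI)
  let ?f = "tw_eval v (TVar i)"
  fix p q
  assume "sampled (encode_term (TVar i)) p q"
  then obtain a where a: "(TVar i, a) \<in> S" "p = rank a" "q = rank (?f a)" "a \<in> levels" "?f a \<in> levels"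
    by (rule sampledE)
  show "q = 0" if "p = 0"
  proof -
    have "a = 0" using that a rank_pos by fastforce
    then show ?thesis using a tw_zero[OF tw, of "TVar i"] by simp
  qed
  show "q = K \<and> avoids_top sampled K (encode_term (TVar i)) \<or> (\<exists>n<K. sampled (encode_term (TVar i)) n q)"
    if "p = K"
  proof -
    have q: "q = rank (?f \<infinity>)" using that a rank_eq_top_iff by metis
    show ?thesis
    proof (cases "unbounded ?f")
      case True
      then show ?thesis using q avoids_top_iff[OF a(1)] by (simp add: unbounded_def)
    next
      case False
      then have "sampled (encode_term (TVar i)) (rank (witness v (TVar i))) q"
        using sampledI[OF sample_closed(2)[OF a(1)]] witness_eval[of "TVar i"] q by metis
      then show ?thesis using rank_finite[OF witness_finite[OF False]] by blast
    qed
  qed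
  fix p' q'
  assume "sampled (encode_term (TVar i)) p' q'" "p \<le> p'"
  then obtain b where b: "p' = rank b" "q' = rank (?f b)" "b \<in> levels" "?f b \<in> levels"
    by (metis sampledE)
  then have "a \<le> b" using \<open>p \<le> p'\<close> a rank_le_iff by simp
  then show "q \<le> q'" using a b rank_le_iff tw_mono[OF tw] by metis
qed

lemma meet_ok:
  assumes s: "(TMeet x y, p0) \<in> S"
  shows "meet_ok sampled K (encode_term (TMeet x y)) (encode_term x) (encode_term y)"
  unfolding meet_ok_def
proof (intro conjI allI impI)
  have "(x, p0) \<in> S" "(y, p0) \<in> S" using sample_closed(3)[OF s] by auto
  then show "avoids_top sampled K (encode_term x) \<or> avoids_top sampled K (encode_term y)"
    if "avoids_top sampled K (encode_term (TMeet x y))"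
    using that finite_valued_inf[OF tw tw, of x y] by (simp only: avoids_top_iff[OF s] avoids_top_iff tw_eval.simps)
  fix p q
  assume "sampled (encode_term (TMeet x y)) p q"
  then obtain a where a: "(TMeet x y, a) \<in> S" "p = rank a" "q = rank (tw_eval v (TMeet x y) a)"
    by (rule sampledE)
  have xy: "(x, a) \<in> S" "(y, a) \<in> S" using sample_closed(3)[OF a(1)] by auto
  let ?a = "rank (tw_eval v x a)" and ?b = "rank (tw_eval v y a)"
  have "?a \<le> ?b \<and> q = ?a \<or> ?b \<le> ?a \<and> q = ?b"
    using a rank_le_iff[OF levels_sample(2)[OF xy(1)] levels_sample(2)[OF xy(2)]]
    by (cases "tw_eval v x a \<le> tw_eval v y a") (auto simp: inf.absorb1 inf.absorb2)
  then show "\<exists>a\<le>K. \<exists>b\<le>K. sampled (encode_term x) p a \<and> sampled (encode_term y) p b \<and>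
      (a \<le> b \<and> q = a \<or> b \<le> a \<and> q = b)"
    using sampledI[OF xy(1)] sampledI[OF xy(2)] rank_le a(2) by blast
qed

lemma join_ok:
  assumes s: "(TJoin x y, p0) \<in> S"
  shows "join_ok sampled K (encode_term (TJoin x y)) (encode_term x) (encode_term y)"
  unfolding join_ok_def
proof (intro conjI[of "_ \<longrightarrow> _"] allI impI)
  have "(x, p0) \<in> S" "(y, p0) \<in> S" using sample_closed(3)[OF s] by auto
  then show "avoids_top sampled K (encode_term x) \<and> avoids_top sampled K (encode_term y)"
    if "avoids_top sampled K (encode_term (TJoin x y))"
    using that by (simp only: avoids_top_iff[OF s] avoids_top_iff tw_eval.simps finite_valued_sup)
  fix p q
  assume "sampled (encode_term (TJoin x y)) p q"
  then obtain a where a: "(TJoin x y, a) \<in> S" "p = rank a" "q = rank (tw_eval v (TJoin x y) a)"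
    by (rule sampledE)
  have xy: "(x, a) \<in> S" "(y, a) \<in> S" using sample_closed(3)[OF a(1)] by auto
  let ?a = "rank (tw_eval v x a)" and ?b = "rank (tw_eval v y a)"
  have "?a \<le> ?b \<and> q = ?b \<or> ?b \<le> ?a \<and> q = ?a"
    using a rank_le_iff[OF levels_sample(2)[OF xy(1)] levels_sample(2)[OF xy(2)]]
    by (cases "tw_eval v x a \<le> tw_eval v y a") (auto simp: sup.absorb1 sup.absorb2)
  then show "\<exists>a\<le>K. \<exists>b\<le>K. sampled (encode_term x) p a \<and> sampled (encode_term y) p b \<and>
      (a \<le> b \<and> q = b \<or> b \<le> a \<and> q = a)"
    using sampledI[OF xy(1)] sampledI[OF xy(2)] rank_le a(2) by blast
qed

lemma comp_ok:
  assumes s: "(TComp x y, p0) \<in> S"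
  shows "comp_ok sampled K (encode_term (TComp x y)) (encode_term x) (encode_term y)"
  unfolding comp_ok_def
proof (intro conjI[of "_ \<longrightarrow> _"] allI impI)
  let ?u = "TComp x y"
  have xy: "(y, p0) \<in> S" "(x, tw_eval v y p0) \<in> S" using sample_closed(3)[OF s] by auto
  show "(\<exists>q<K. sampled (encode_term ?u) K q) \<or>
      avoids_top sampled K (encode_term x) \<and> avoids_top sampled K (encode_term y)"
    if "avoids_top sampled K (encode_term ?u)"
  proof -
    have "finite_valued (tw_eval v x \<circ> tw_eval v y)"
      using that by (simp only: avoids_top_iff[OF s] tw_eval.simps)
    then consider "tw_eval v ?u \<infinity> \<noteq> \<infinity>" | "finite_valued (tw_eval v x)" "finite_valued (tw_eval v y)"
      unfolding finite_valued_comp[OF tw tw] by auto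
    then show ?thesis
    proof cases
      case 1
      then show ?thesis using sampled_topI[OF sample_closed(1)[OF s]] rank_finite by blast
    qed (simp add: avoids_top_iff[OF xy(1)] avoids_top_iff[OF xy(2)])
  qed
  fix p q
  assume "sampled (encode_term ?u) p q"
  then obtain a where a: "(?u, a) \<in> S" "p = rank a" "q = rank (tw_eval v ?u a)"
    by (rule sampledE)
  have xy: "(y, a) \<in> S" "(x, tw_eval v y a) \<in> S" using sample_closed(3)[OF a(1)] by auto
  show "\<exists>a\<le>K. sampled (encode_term y) p a \<and> sampled (encode_term x) a q"
    using sampledI[OF xy(1)] sampledI[OF xy(2)] rank_le[of "tw_eval v y a"] a by auto
qed

lemma ldiv_ok:
  assumes s: "(TLdiv x y, p0) \<in> S"
  shows "ldiv_ok sampled K (encode_term (TLdiv x y)) (encode_term x) (encode_term y)"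
  unfolding ldiv_ok_def
proof (intro conjI[of "_ \<longrightarrow> _"] allI impI)
  let ?u = "TLdiv x y" and ?f = "tw_eval v x" and ?h = "tw_eval v y"
  have y: "(y, p0) \<in> S" and x: "(x, tw_eval v ?u p0) \<in> S" using sample_closed(3)[OF s] by auto
  note top = sample_closed(1)[OF x] sample_closed(1)[OF y]
  show "(\<exists>a\<le>K. \<exists>b\<le>K. sampled (encode_term y) K a \<and> sampled (encode_term x) K b \<and> a < b) \<or>
      sampled (encode_term x) K K \<and> avoids_top sampled K (encode_term y)"
    if "avoids_top sampled K (encode_term ?u)"
  proof -
    have "finite_valued (tw_ldiv ?f ?h)" using that by (simp only: avoids_top_iff[OF s] tw_eval.simps)
    then consider "?h \<infinity> < ?f \<infinity>" | "?f \<infinity> = \<infinity>" "finite_valued ?h"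
      unfolding finite_valued_tw_ldiv[OF tw tw] by metis
    then show ?thesis
    proof cases
      case 1
      then have "rank (?h \<infinity>) < rank (?f \<infinity>)" using rank_less_iff levels_sample(2) top by blast
      then show ?thesis using sampled_topI[OF top(1)] sampled_topI[OF top(2)] rank_le by blast
    next
      case 2
      then show ?thesis using sampled_topI[OF top(1)] avoids_top_iff[OF y] by simp
    qed
  qed
  fix p q
  assume "sampled (encode_term ?u) p q"
  then obtain a where a: "(?u, a) \<in> S" "p = rank a" "q = rank (tw_eval v ?u a)" "a \<in> levels"
    by (rule sampledE)
  define r where "r = tw_eval v ?u a"
  have ya: "(y, a) \<in> S" and xr: "(x, r) \<in> S" and xSr: "(x, eSuc r) \<in> S"
    using sample_closed(3)[OF a(1)] by (auto simp: r_def)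
  have r: "tw_ldiv ?f ?h a = r" and q: "q = rank r" using a by (auto simp: r_def)
  \<comment> \<open>The successor pair requested by \<open>needs\<close> remains a successor pair of
    finite points after compression.\<close>
  have step: "q < K \<longrightarrow> r \<noteq> \<infinity> \<and> rank (eSuc r) = Suc q \<and> Suc q < K"
  proof
    assume "q < K"
    then have "r \<noteq> \<infinity>" using q rank_less_top_iff by blast
    moreover from this have "rank (eSuc r) = Suc q"
      using q rank_eSuc levels_sample(1)[OF xr] by blast
    moreover have "eSuc r \<noteq> \<infinity>" using \<open>r \<noteq> \<infinity>\<close> by (metis eSuc_infinity eSuc_inject)
    ultimately show "r \<noteq> \<infinity> \<and> rank (eSuc r) = Suc q \<and> Suc q < K" using rank_finite by metis
  qed
  show "p = 0 \<and> q = 0 \<or>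
      0 < p \<and> (p < K \<or> \<not> reaches_top_late sampled K (encode_term y)) \<and>
        (\<exists>a\<le>K. \<exists>b\<le>K. sampled (encode_term y) p a \<and> sampled (encode_term x) q b \<and> b \<le> a \<and>
          (q < K \<longrightarrow> Suc q < K \<and> (\<exists>d\<le>K. sampled (encode_term x) (Suc q) d \<and> a < d))) \<or>
      p = K \<and> reaches_top_late sampled K (encode_term y) \<and>
        (q = K \<and> avoids_top sampled K (encode_term x) \<or>
         Suc q < K \<and> (\<exists>b<K. sampled (encode_term x) q b) \<and> sampled (encode_term x) (Suc q) K)"
  proof (cases "a = 0")
    case True
    then show ?thesis using a tw_zero[OF tw, of ?u] by simp
  next
    case a0: False
    then have p: "0 < p" "0 < a" using a rank_pos by auto
    show ?thesis
    proof (cases "a \<noteq> \<infinity> \<or> \<not> unbounded ?h")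
      case True
      then have fr: "?f r \<le> ?h a" "r \<noteq> \<infinity> \<longrightarrow> ?h a < ?f (eSuc r)"
        using tw_ldiv_eq_iff[OF tw tw p(2), of y x r] r by auto
      have "p < K \<or> \<not> reaches_top_late sampled K (encode_term y)"
        using True a rank_finite reaches_top_late_iff[OF y] by blast
      moreover have "sampled (encode_term y) p (rank (?h a))" using sampledI[OF ya] a by simp
      moreover have "sampled (encode_term x) q (rank (?f r))" using sampledI[OF xr] q by simp
      moreover have "rank (?f r) \<le> rank (?h a)" using fr(1) rank_le_iff levels_sample(2) xr ya by blast
      moreover have "q < K \<longrightarrow> Suc q < K \<and> (\<exists>d\<le>K. sampled (encode_term x) (Suc q) d \<and> rank (?h a) < d)"
      proof
        assume "q < K"
        then have "?h a < ?f (eSuc r)" "rank (eSuc r) = Suc q" "Suc q < K" using step fr(2) by auto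
        then have "rank (?h a) < rank (?f (eSuc r))" "sampled (encode_term x) (Suc q) (rank (?f (eSuc r)))"
          using rank_less_iff levels_sample(2) xSr ya sampledI[OF xSr] by (blast, simp)
        then show "Suc q < K \<and> (\<exists>d\<le>K. sampled (encode_term x) (Suc q) d \<and> rank (?h a) < d)"
          using rank_le \<open>Suc q < K\<close> by blast
      qed
      ultimately show ?thesis using p(1) rank_le[of "?h a"] rank_le[of "?f r"] by blast
    next
      case False
      then have "a = \<infinity>" and late: "reaches_top_late sampled K (encode_term y)"
        using reaches_top_late_iff[OF y] by auto
      then have "p = K" using a by simp
      consider "r = \<infinity>" "finite_valued ?f" | "r \<noteq> \<infinity>" "?f r < \<infinity>" "?f (eSuc r) = \<infinity>"
        using tw_ldiv_infinity_eq_iff[OF tw tw, of y x r] r False by auto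
      then show ?thesis
      proof cases
        case 1
        then show ?thesis using \<open>p = K\<close> late q avoids_top_iff[OF x] by simp
      next
        case 2
        then have "q < K" using q rank_finite by blast
        then have "rank (eSuc r) = Suc q" "Suc q < K" using step by auto
        moreover have "sampled (encode_term x) (Suc q) K"
          using sampledI[OF xSr] 2 calculation by simp
        moreover have "rank (?f r) < K" using 2 rank_finite[of "?f r"] by simp
        moreover have "sampled (encode_term x) q (rank (?f r))" using sampledI[OF xr] q by simp
        ultimately show ?thesis using \<open>p = K\<close> late by blast
      qed
    qed
  qed
qed

lemma rdiv_ok:
  assumes s: "(TRdiv x y, p0) \<in> S"
  shows "rdiv_ok sampled K (encode_term (TRdiv x y)) (encode_term x) (encode_term y)"
  unfolding rdiv_ok_def
proof (intro conjI[of "_ \<longrightarrow> _"] allI impI)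
  let ?u = "TRdiv x y" and ?h = "tw_eval v x" and ?g = "tw_eval v y"
  \<comment> \<open>Any sampled point of \<open>x\<close> and \<open>y\<close> would do here, so the
    least number may be unspecified.\<close>
  have y: "(y, LEAST m. p0 \<le> ?g m) \<in> S" and x: "(x, LEAST m. p0 \<le> ?g m) \<in> S"
    using sample_closed(3)[OF s] by (auto simp: Let_def)
  note top = sample_closed(1)[OF x] sample_closed(1)[OF y]
  show "(\<exists>q<K. sampled (encode_term ?u) K q) \<or>
      reaches_top_late sampled K (encode_term y) \<and> avoids_top sampled K (encode_term x)"
    if "avoids_top sampled K (encode_term ?u)"
  proof -
    have "finite_valued (tw_rdiv ?h ?g)" using that by (simp only: avoids_top_iff[OF s] tw_eval.simps)
    then consider "tw_eval v ?u \<infinity> \<noteq> \<infinity>" | "unbounded ?g" "finite_valued ?h"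
      unfolding finite_valued_tw_rdiv[OF tw tw] by auto
    then show ?thesis
    proof cases
      case 1
      then show ?thesis using sampled_topI[OF sample_closed(1)[OF s]] rank_finite by blast
    qed (simp add: avoids_top_iff[OF x] reaches_top_late_iff[OF y])
  qed
  fix p q
  assume "sampled (encode_term ?u) p q"
  then obtain a where a: "(?u, a) \<in> S" "p = rank a" "q = rank (tw_eval v ?u a)" "a \<in> levels"
    by (rule sampledE)
  show "p = 0 \<and> q = 0 \<or>
      0 < p \<and> (\<exists>a<p. sampled (encode_term y) K a) \<and> q = K \<or>
      0 < p \<and> (\<exists>n<K. Suc n < K \<and> (\<exists>a\<le>K. sampled (encode_term y) (Suc n) a \<and> p \<le> a) \<and>
        (\<exists>b<p. sampled (encode_term y) n b) \<and> sampled (encode_term x) (Suc n) q) \<or>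
      0 < p \<and> p = K \<and> reaches_top_late sampled K (encode_term y) \<and> sampled (encode_term x) K q"
  proof (cases "a = 0")
    case True
    then show ?thesis using a tw_zero[OF tw, of ?u] by simp
  next
    case a0: False
    then have p: "0 < p" "0 < a" using a rank_pos by auto
    consider "?g \<infinity> < a" "tw_eval v ?u a = \<infinity>"
      | n where "a \<le> ?g (enat (Suc n))" "?g (enat n) < a" "tw_eval v ?u a = ?h (enat (Suc n))"
      | "a = \<infinity>" "unbounded ?g" "tw_eval v ?u a = ?h \<infinity>"
      using tw_rdiv_eq_iff[OF tw tw p(2), of x y "tw_eval v ?u a"] by auto
    then show ?thesis
    proof cases
      case 1
      then have "rank (?g \<infinity>) < p" using a rank_less_iff levels_sample(2)[OF top(2)] by simp
      then show ?thesis using 1 a p sampled_topI[OF top(2)] by auto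
    next
      case 2
      \<comment> \<open>The crossing found by \<open>tw_rdiv_eq_iff\<close> is the least number
        chosen in \<open>needs\<close>, so both of its sides are sampled.\<close>
      have "(LEAST m. a \<le> ?g m) = enat (Suc n)"
      proof (rule Least_equality)
        fix m
        assume "a \<le> ?g m"
        then have "\<not> m \<le> enat n" using 2(2) tw_mono[OF tw, of m "enat n" y] by (meson leD order_trans)
        then show "enat (Suc n) \<le> m" by (cases m) auto
      qed (rule 2(1))
      then have yS: "(y, enat (Suc n)) \<in> S" and yn: "(y, enat n) \<in> S" and xS: "(x, enat (Suc n)) \<in> S"
        using sample_closed(3)[OF a(1)] by (auto simp: Let_def one_enat_def)
      have S: "rank (enat (Suc n)) = Suc (rank (enat n))"
        using rank_eSuc[OF levels_sample(1)[OF yn]] by (simp add: eSuc_enat)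
      have "Suc (rank (enat n)) < K" using rank_finite[of "enat (Suc n)"] S by simp
      moreover have "p \<le> rank (?g (enat (Suc n)))"
        using 2(1) a rank_le_iff levels_sample(2)[OF yS] by simp
      moreover have "rank (?g (enat n)) < p"
        using 2(2) a rank_less_iff levels_sample(2)[OF yn] by simp
      moreover have "sampled (encode_term x) (Suc (rank (enat n))) q"
        using sampledI[OF xS] S a 2(3) by simp
      moreover have "sampled (encode_term y) (Suc (rank (enat n))) (rank (?g (enat (Suc n))))"
        using sampledI[OF yS] S by simp
      moreover have "sampled (encode_term y) (rank (enat n)) (rank (?g (enat n)))"
        by (rule sampledI[OF yn])
      ultimately show ?thesis using p(1) rank_le[of "?g (enat (Suc n))"] Suc_lessD by blast
    next
      case 3
      then show ?thesis
        using a p sampled_topI[OF top(1)] reaches_top_late_iff[OF y] by simp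
    qed
  qed
qed

lemma diagram_sampled: "diagram sampled K c"
proof -
  have 1: "var_ok sampled K (prod_encode (0, i))" for i
    using var_ok[of i] by simp
  have 2: "active sampled K x \<and> active sampled K y \<and>
      (k = 1 \<longrightarrow> meet_ok sampled K (prod_encode (k, prod_encode (x, y))) x y) \<and>
      (k = 2 \<longrightarrow> join_ok sampled K (prod_encode (k, prod_encode (x, y))) x y) \<and>
      (k = 3 \<longrightarrow> comp_ok sampled K (prod_encode (k, prod_encode (x, y))) x y) \<and>
      (k = 4 \<longrightarrow> ldiv_ok sampled K (prod_encode (k, prod_encode (x, y))) x y) \<and>
      (k = 5 \<longrightarrow> rdiv_ok sampled K (prod_encode (k, prod_encode (x, y))) x y)"
    if k: "0 < k" "k \<le> 5" and act: "active sampled K (prod_encode (k, prod_encode (x, y)))" for x y k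
  proof -
    \<comment> \<open>An active code belongs to a sampled term, and injectivity of pairing lets the
      tag k identify its outermost operation.\<close>
    obtain u p where s: "(u, p) \<in> S" and eq: "prod_encode (k, prod_encode (x, y)) = encode_term u"
      using act by (rule active_sampledE)
    note need = sample_closed(3)[OF s]
    show ?thesis
    proof (cases u)
      case (TMeet a b)
      then have [simp]: "k = 1" "x = encode_term a" "y = encode_term b" using eq by auto
      show ?thesis using s need meet_ok active_sampled unfolding TMeet by simp blast
    next
      case (TJoin a b)
      then have [simp]: "k = 2" "x = encode_term a" "y = encode_term b" using eq by auto
      show ?thesis using s need join_ok active_sampled unfolding TJoin by simp blast
    next
      case (TComp a b)
      then have [simp]: "k = 3" "x = encode_term a" "y = encode_term b" using eq by auto
      show ?thesis using s need comp_ok active_sampled unfolding TComp by simp blast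
    next
      case (TLdiv a b)
      then have [simp]: "k = 4" "x = encode_term a" "y = encode_term b" using eq by auto
      show ?thesis using s need ldiv_ok active_sampled unfolding TLdiv by simp blast
    next
      case (TRdiv a b)
      then have [simp]: "k = 5" "x = encode_term a" "y = encode_term b" using eq by auto
      show ?thesis using s need rdiv_ok active_sampled unfolding TRdiv by (simp add: Let_def) blast
    qed (use eq k in auto)
  qed
  have 3: "q = p" if "sampled (prod_encode (6, 0)) p q" for p q
    using that sampledE[of TId p q] by (metis encode_term.simps(7) id_apply tw_eval.simps(7))
  have 4: "q = 0" if "sampled (prod_encode (7, 0)) p q" for p q
    using that sampledE[of TBot p q] rank_zero
    by (metis encode_term.simps(8) tw_eval.simps(8) tw_bot_def)
  have 5: "(p = 0 \<and> q = 0 \<or> 0 < p \<and> q = K) \<and> \<not> avoids_top sampled K (prod_encode (8, 0))"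
    if "sampled (prod_encode (8, 0)) p q" for p q
  proof -
    have "sampled (encode_term TTop) p q" using that by simp
    then obtain a where a: "(TTop, a) \<in> S" "p = rank a" "q = rank (tw_eval v TTop a)" "a \<in> levels"
      by (rule sampledE)
    have "\<not> finite_valued tw_top"
      by (auto simp: finite_valued_def tw_top_def zero_enat_def intro!: exI[of _ "1::nat"])
    then have "\<not> avoids_top sampled K (prod_encode (8, 0))" using avoids_top_iff[OF a(1)] by simp
    moreover have "p = 0 \<and> q = 0 \<or> 0 < p \<and> q = K"
      using a rank_pos by (cases "a = 0") (auto simp: tw_top_def)
    ultimately show ?thesis by blast
  qed
  show ?thesis unfolding diagram_def
    by (rule conjI, use 1 in blast, rule conjI, intro allI impI, rule 2, simp, simp, simp)
      (use 3 4 5 in blast)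
qed

lemma refutes_sampled:
  assumes "(s, p) \<in> S" "(t, p) \<in> S" "tw_eval v s p \<noteq> tw_eval v t p"
  shows "refutes sampled K (encode_term s) (encode_term t)"
proof -
  have "rank (tw_eval v s p) \<noteq> rank (tw_eval v t p)"
    using assms rank_eq_iff levels_sample(2) by blast
  then show ?thesis unfolding refutes_def
    using diagram_sampled assms active_sampled sampledI rank_le by blast
qed

text \<open>A relation given by finitely many triples is one natural number, with a binary digit for
  each triple; the bound is a geometric sum.\<close>

lemma sampled_coded:
  assumes bound: "\<And>u p. (u, p) \<in> S \<Longrightarrow> encode_term u \<le> c"
  shows "\<exists>r<2 ^ Suc (prod_encode (c, prod_encode (K, K))). coded r = sampled"
proof -
  define I where "I = (\<lambda>(u, a). prod_encode (encode_term u, prod_encode (rank a, rank (tw_eval v u a)))) ` S"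
  have "finite I" by (simp add: I_def finite_S)
  have "I \<subseteq> {..<Suc (prod_encode (c, prod_encode (K, K)))}"
    using bound rank_le by (auto simp: I_def less_Suc_eq_le intro!: prod_encode_mono)
  then have "set_encode I \<le> sum ((^) 2) {..<Suc (prod_encode (c, prod_encode (K, K)))}"
    unfolding set_encode_def by (intro sum_mono2) auto
  also have "\<dots> < 2 ^ Suc (prod_encode (c, prod_encode (K, K)))"
    by (subst lessThan_atLeast0, subst sum_power2) simp
  finally have "set_encode I < 2 ^ Suc (prod_encode (c, prod_encode (K, K)))" .
  moreover have "coded (set_encode I) = sampled"
  proof (intro ext)
    fix x p q
    show "coded (set_encode I) x p q = sampled x p q"
      unfolding coded_def set_encode_inverse[OF \<open>finite I\<close>] unfolding I_def image_iff sampled_def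
      by (rule bex_cong[OF refl]) (auto simp: prod_encode_eq)
  qed
  ultimately show ?thesis by blast
qed

end

section \<open>Correctness of the bounded search\<close>

lemma refutes_complete:
  assumes "\<not> W_models s t"
  defines "m \<equiv> encode_term s" and "n \<equiv> encode_term t"
  shows "\<exists>r<code_bound m n. refutes (coded r) (size_bound m n) m n"
proof -
  obtain v p where v: "\<And>i. v i \<in> time_warps" and p: "tw_eval v s p \<noteq> tw_eval v t p"
    using assms(1) unfolding W_models_def by (metis ext)
  obtain A where A: "small_samples v s {p} A" using small_samples_exist by blast
  obtain B where B: "small_samples v t {p} B" using small_samples_exist by blast
  \<comment> \<open>The single starting point p gives the factor 4 = 1 + 3 in both bounds.\<close>
  have "card (A \<union> B) \<le> 4 * 8 ^ m + 4 * 8 ^ n"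
    using card_Un_le[of A B] A B by (simp add: small_samples_def m_def n_def)
  moreover have "(8::nat) ^ m \<le> 8 ^ m * 8 ^ n" "(8::nat) ^ n \<le> 8 ^ m * 8 ^ n" "(1::nat) \<le> 8 ^ m * 8 ^ n"
    by simp_all
  ultimately have "2 * card (A \<union> B) + 2 < 64 * (8 ^ m * 8 ^ n)" by linarith
  then have K: "2 * card (A \<union> B) + 2 < size_bound m n"
    by (simp add: size_bound_def power_add mult.commute)
  interpret samples v "A \<union> B" "size_bound m n"
    by unfold_locales (use v A B K closed_samples_Un in \<open>auto simp: small_samples_def\<close>)
  have "encode_term u \<le> m + n" if "(u, a) \<in> A \<union> B" for u a
    using that A B by (fastforce simp: small_samples_def m_def n_def)
  then obtain r where "r < code_bound m n" "coded r = sampled"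
    using sampled_coded[of "m + n"] unfolding code_bound_def by blast
  moreover have "refutes sampled (size_bound m n) m n"
    unfolding m_def n_def using refutes_sampled[of s p t] A B p
    by (auto simp: small_samples_def m_def n_def)
  ultimately show ?thesis by metis
qed

theorem theorem1p1:
  shows "\<exists>p. \<forall>s t. rec_eval p [encode_term s, encode_term t]
                          (if W_models s t then 1 else 0)"
proof -
  have models: "W_models s t \<longleftrightarrow> \<not> (\<exists>r<code_bound (encode_term s) (encode_term t).
      refutes (coded r) (size_bound (encode_term s) (encode_term t)) (encode_term s) (encode_term t))" for s t
  proof -
    \<comment> \<open>Positivity keeps 0 and infinity apart in the table.\<close>
    have "0 < size_bound (encode_term s) (encode_term t)" by (simp add: size_bound_def)
    from refutes_complete[of s t] refutes_sound[OF this] show ?thesis by blast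
  qed
  obtain p where "\<And>xs. length xs = 2 \<Longrightarrow> rec_eval p xs
      (if \<not> (\<exists>r<code_bound (hd xs) (hd (tl xs)).
        refutes (coded r) (size_bound (hd xs) (hd (tl xs))) (hd xs) (hd (tl xs))) then 1 else 0)"
    using decidable_not[OF decidable_refutable] unfolding decidable_def computable_def by blast
  from this[of "[_, _]"] show ?thesis unfolding models by (intro exI[of _ p]) simp
qed

end
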